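(* Let $X_1, X_2$ be Banach spaces and let $X_1\times X_2$ be equipped with the norm $\|(x_1,x_2)\|=\sqrt{\|x_1\|^2+\|x_2\|^2}$. Let $A_1: D(A_1)\subset X_1\times X_2\to X_1$ and $A_2: D(A_2)\subset X_1\to X_2$ be linear operators such that the operator $A_{ext}$ on $X_1\times X_2$ defined by $$A_{ext}\begin{pmatrix}x_1 \\ x_2\end{pmatrix}=\begin{pmatrix}A_1\begin{pmatrix}x_1 \\ x_2\end{pmatrix} \\ A_2x_1\end{pmatrix},\qquad D(A_{ext})=\{(x_1,x_2)\in X_1\times X_2 : x_1\in D(A_2)\ \text{and}\ (x_1,x_2)\in D(A_1)\},$$ generates a contraction $C_0$-semigroup on $X_1\times X_2$. Let $S:X_2\to X_2$ be a bounded linear operator which is boundedly invertible, and suppose that there exist $m_2>0$ and a semi-inner-product $[\cdot,\cdot]_2$ on $X_2$ such that $$\operatorname{Re}[x,Sx]_2\ge m_2\|x\|^2\qquad\text{for all } x\in X_2.$$ Define the operator $A_S$ on $X_1$ by $$A_Sx=A_1\begin{pmatrix}x \\ S A_2x\end{pmatrix},\qquad D(A_S)=\{x\in X_1 : (x,S A_2x)\in D(A_{ext})\}.$$ If $D(A_S)$ is dense in $X_1$ or $X_1$ is reflexive, then $A_S$ generates a contraction $C_0$-semigroup on $X_1$.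
   Context: Banach spaces are over $\mathbb{C}$. A semi-inner-product (SIP) on a Banach space $X$ is a mapping $[\cdot,\cdot]:X\times X\to\mathbb{C}$ such that for all $x,y,z\in X$ and $\lambda\in\mathbb{C}$: $[x+\lambda z,y]=[x,y]+\lambda[z,y]$; $[x,x]=\|x\|^2$ (where $\|\cdot\|$ is the given norm of $X$); and $|[x,y]|^2\le[x,x]\,[y,y]$. No linearity or additivity in the second argument is required. "Boundedly invertible" means that $S$ is bijective with bounded inverse $S^{-1}$. The condition $(x,S A_2x)\in D(A_{ext})$ includes the requirement $x\in D(A_2)$, so that $A_2x$ is defined. A contraction $C_0$-semigroup is a strongly continuous semigroup $(T(t))_{t\ge0}$ of bounded linear operators with $\|T(t)\|\le1$ for all $t\ge0$. *)

theory Defs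
  imports "HOL-Analysis.Analysis"
begin

text \<open>The libraries only provide normed spaces over the reals. A complex normed space is a real
  normed space with a complex scalar multiplication that extends the real one.\<close>

class complex_normed_vector = real_normed_vector +
  fixes scaleC :: "complex \<Rightarrow> 'a \<Rightarrow> 'a" (infixr "*\<^sub>C" 75)
  assumes scaleC_add_right: "c *\<^sub>C (x + y) = c *\<^sub>C x + c *\<^sub>C y"
    and scaleC_add_left: "(c + d) *\<^sub>C x = c *\<^sub>C x + d *\<^sub>C x"
    and scaleC_scaleC: "c *\<^sub>C (d *\<^sub>C x) = (c * d) *\<^sub>C x"
    and scaleC_of_real: "complex_of_real r *\<^sub>C x = r *\<^sub>R x"
    and norm_scaleC: "norm (c *\<^sub>C x) = cmod c * norm x"

class complex_banach = complex_normed_vector + banach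

instantiation complex :: complex_banach
begin
definition scaleC_complex_def: "c *\<^sub>C (z::complex) = c * z"
instance
  by standard (auto simp: scaleC_complex_def algebra_simps norm_mult scaleR_conv_of_real)
end

instantiation prod :: (complex_normed_vector, complex_normed_vector) complex_normed_vector
begin
definition scaleC_prod_def: "c *\<^sub>C p = (c *\<^sub>C fst p, c *\<^sub>C snd p)"
instance
proof
  fix c :: complex and p :: "'a \<times> 'b"
  have "norm (c *\<^sub>C p) = sqrt ((cmod c)\<^sup>2 * ((norm (fst p))\<^sup>2 + (norm (snd p))\<^sup>2))"
    by (simp add: scaleC_prod_def norm_prod_def norm_scaleC power_mult_distrib distrib_left)
  then show "norm (c *\<^sub>C p) = cmod c * norm p"
    by (simp add: norm_prod_def real_sqrt_mult)
qed (auto simp: scaleC_prod_def scaleC_add_right scaleC_add_left scaleC_scaleC scaleC_of_real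
      scaleR_prod_def)
end

text \<open>The norm on the product is the library norm, i.e.
  \<open>norm (x, y) = sqrt ((norm x)\<^sup>2 + (norm y)\<^sup>2)\<close>, see \<open>norm_Pair\<close>.\<close>

instance prod :: (complex_banach, complex_banach) complex_banach ..

lemma vector_space_scaleC:
  "vector_space (scaleC :: complex \<Rightarrow> 'a \<Rightarrow> 'a::complex_normed_vector)"
proof
  show "1 *\<^sub>C x = x" for x :: 'a
    using scaleC_of_real[of 1 x] by simp
qed (auto simp: scaleC_add_right scaleC_add_left scaleC_scaleC)

definition bounded_clinear :: "('a::complex_normed_vector \<Rightarrow> 'b::complex_normed_vector) \<Rightarrow> bool"
  where "bounded_clinear f \<longleftrightarrow> bounded_linear f \<and> (\<forall>c x. f (c *\<^sub>C x) = c *\<^sub>C f x)"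

definition boundedly_invertible :: "('a::complex_normed_vector \<Rightarrow> 'b::complex_normed_vector) \<Rightarrow> bool"
  where "boundedly_invertible S \<longleftrightarrow> bij S \<and> bounded_clinear (inv S)"

text \<open>An unbounded operator is a pair of a domain \<open>D\<close> and a total function \<open>A\<close> whose values
  outside \<open>D\<close> are irrelevant.\<close>

definition linear_operator ::
    "'a::complex_normed_vector set \<Rightarrow> ('a \<Rightarrow> 'b::complex_normed_vector) \<Rightarrow> bool"
  where "linear_operator D A \<longleftrightarrow> module.subspace scaleC D \<and>
    (\<forall>x\<in>D. \<forall>y\<in>D. \<forall>c. A (x + c *\<^sub>C y) = A x + c *\<^sub>C A y)"

text \<open>The semigroup is a function on the real line that is only constrained on \<open>{0..}\<close>.\<close>

definition contraction_C0_semigroup :: "(real \<Rightarrow> 'a::complex_normed_vector \<Rightarrow> 'a) \<Rightarrow> bool"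
  where "contraction_C0_semigroup T \<longleftrightarrow>
    (\<forall>t\<ge>0. bounded_clinear (T t) \<and> onorm (T t) \<le> 1) \<and>
    T 0 = id \<and>
    (\<forall>s\<ge>0. \<forall>t\<ge>0. T (s + t) = T s \<circ> T t) \<and>
    (\<forall>x. continuous_on {0..} (\<lambda>t. T t x))"

definition infinitesimal_generator ::
    "(real \<Rightarrow> 'a::complex_normed_vector \<Rightarrow> 'a) \<Rightarrow> 'a set \<Rightarrow> ('a \<Rightarrow> 'a) \<Rightarrow> bool"
  where "infinitesimal_generator T D A \<longleftrightarrow>
    D = {x. \<exists>y. ((\<lambda>h. (T h x - x) /\<^sub>R h) \<longlongrightarrow> y) (at_right 0)} \<and>
    (\<forall>x\<in>D. ((\<lambda>h. (T h x - x) /\<^sub>R h) \<longlongrightarrow> A x) (at_right 0))"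

definition generates_contraction_C0_semigroup ::
    "'a::complex_normed_vector set \<Rightarrow> ('a \<Rightarrow> 'a) \<Rightarrow> bool"
  where "generates_contraction_C0_semigroup D A \<longleftrightarrow>
    (\<exists>T. contraction_C0_semigroup T \<and> infinitesimal_generator T D A)"

definition semi_inner_product :: "('a::complex_normed_vector \<Rightarrow> 'a \<Rightarrow> complex) \<Rightarrow> bool"
  where "semi_inner_product ip \<longleftrightarrow>
    (\<forall>x y z c. ip (x + c *\<^sub>C z) y = ip x y + c * ip z y) \<and>
    (\<forall>x. ip x x = complex_of_real ((norm x)\<^sup>2)) \<and>
    (\<forall>x y. (cmod (ip x y))\<^sup>2 \<le> Re (ip x x * ip y y))"

text \<open>Reflexivity: the canonical map into the bidual is onto. Elements of the dual are bounded
  functionals, normed by \<open>onorm\<close>; an element of the bidual is represented by a function on all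
  functionals, of which only the restriction to \<open>cdual\<close> matters.\<close>

definition cdual :: "('a::complex_normed_vector \<Rightarrow> complex) set"
  where "cdual = {f. bounded_clinear f}"

definition cbidual :: "(('a::complex_normed_vector \<Rightarrow> complex) \<Rightarrow> complex) set"
  where "cbidual = {\<phi>.
    (\<forall>f\<in>cdual. \<forall>g\<in>cdual. \<forall>c. \<phi> (\<lambda>x. f x + c * g x) = \<phi> f + c * \<phi> g) \<and>
    (\<exists>K. \<forall>f\<in>cdual. cmod (\<phi> f) \<le> K * onorm f)}"

definition reflexive_space :: "'a::complex_normed_vector itself \<Rightarrow> bool"
  where "reflexive_space _ \<longleftrightarrow>
    (\<forall>\<phi>\<in>(cbidual :: (('a \<Rightarrow> complex) \<Rightarrow> complex) set). \<exists>x. \<forall>f\<in>cdual. \<phi> f = f x)"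

definition ext_dom :: "('a \<times> 'b) set \<Rightarrow> 'a set \<Rightarrow> ('a \<times> 'b) set"
  where "ext_dom D\<^sub>1 D\<^sub>2 = {(x\<^sub>1, x\<^sub>2). x\<^sub>1 \<in> D\<^sub>2 \<and> (x\<^sub>1, x\<^sub>2) \<in> D\<^sub>1}"

definition ext_op :: "('a \<times> 'b \<Rightarrow> 'a) \<Rightarrow> ('a \<Rightarrow> 'b) \<Rightarrow> 'a \<times> 'b \<Rightarrow> 'a \<times> 'b"
  where "ext_op A\<^sub>1 A\<^sub>2 = (\<lambda>(x\<^sub>1, x\<^sub>2). (A\<^sub>1 (x\<^sub>1, x\<^sub>2), A\<^sub>2 x\<^sub>1))"

definition feedback_dom ::
    "('a \<times> 'b) set \<Rightarrow> 'a set \<Rightarrow> ('a \<Rightarrow> 'b) \<Rightarrow> ('b \<Rightarrow> 'b) \<Rightarrow> 'a set"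
  where "feedback_dom D\<^sub>1 D\<^sub>2 A\<^sub>2 S = {x \<in> D\<^sub>2. (x, S (A\<^sub>2 x)) \<in> ext_dom D\<^sub>1 D\<^sub>2}"

definition feedback_op ::
    "('a \<times> 'b \<Rightarrow> 'a) \<Rightarrow> ('a \<Rightarrow> 'b) \<Rightarrow> ('b \<Rightarrow> 'b) \<Rightarrow> 'a \<Rightarrow> 'a"
  where "feedback_op A\<^sub>1 A\<^sub>2 S = (\<lambda>x. A\<^sub>1 (x, S (A\<^sub>2 x)))"

end

theory Submission
  imports Defs
begin

text \<open>Put \<open>z = (x, S (A\<^sub>2 x))\<close>. Since the extended semigroup is contractive, \<open>norm (z + h A\<^sub>e\<^sub>x\<^sub>t z)\<close> exceeds
  \<open>norm z\<close> by at most \<open>o(h)\<close>; bounding the second component below with the semi-inner-product leaves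
  \<open>norm (x + h A\<^sub>S x) \<le> norm x + o(h)\<close>, so \<open>A\<^sub>S\<close> is dissipative. Solving \<open>\<mu> x - A\<^sub>S x = y\<close> amounts to solving
  \<open>P z - A\<^sub>e\<^sub>x\<^sub>t z = (y, 0)\<close> with \<open>P = diag (\<mu>, S\<^sup>-\<^sup>1)\<close>. Because \<open>S\<^sup>-\<^sup>1\<close> is strictly accretive, the lower bound
  is uniform on the segment from the identity to \<open>P\<close>, and the method of continuity applies. The
  semigroup generated by \<open>A\<^sub>S\<close> is the limit of the dyadic implicit Euler scheme
  \<open>(1 - (t / N) A\<^sub>S)\<^sup>-\<^sup>N\<close>, \<open>N = 2\<^sup>n\<close>. In a reflexive space the density of the domain follows from the
  Hahn-Banach theorem.\<close>

section \<open>The Hahn-Banach theorem\<close>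

text \<open>The accretivity of \<open>S\<close> is known for one given pairing, and none is given on
  the first space. The core estimate is therefore a hybrid: \<open>ip\<close> on the second
  component, plain norm inequalities on the first, joined by the Cauchy-Schwarz inequality of the
  product norm. The argument order in the hypothesis on \<open>S\<close> is the one that fits: the
  second components of \<open>ext_op\<close> at \<open>z\<close> and of \<open>z\<close> itself are
  \<open>A\<^sub>2 x\<close> and \<open>S (A\<^sub>2 x)\<close>. The range condition is the harder
  half. The semigroup only provides scalar shifts of its generator, whereas the shift needed here
  acts as an operator on the second component; this is why a continuity argument enters. The zero on
  the right-hand side is what forces the second component to be \<open>S (A\<^sub>2 x)\<close>.
  Euler steps with step sizes \<open>a\<close> and \<open>b\<close> differ from one step of size
  \<open>a + b\<close> by a term containing \<open>A\<close> twice. All convergence is therefore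
  proved on the domain of the square of \<open>A\<close> and carried over to the whole space by
  nonexpansiveness, which is where density of the domain is used.\<close>

definition sublinear :: "('v::real_vector \<Rightarrow> real) \<Rightarrow> bool"
  where "sublinear p \<longleftrightarrow>
    (\<forall>x y. p (x + y) \<le> p x + p y) \<and> (\<forall>r\<ge>0. \<forall>x. p (r *\<^sub>R x) = r * p x)"

text \<open>One inequality for homogeneity suffices: used for \<open>1 / r\<close> at the point
  \<open>r *\<^sub>R x\<close>, it gives the reverse one. This suits functionals defined by
  infima.\<close>

lemma sublinearI:
  assumes add: "\<And>x y. p (x + y) \<le> p x + p y"
    and scale: "\<And>r x. r > 0 \<Longrightarrow> p (r *\<^sub>R x) \<le> r * p x" and zero: "p 0 = 0"
  shows "sublinear p"
  unfolding sublinear_def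
proof (intro conjI allI impI)
  fix r :: real and x assume "r \<ge> 0"
  show "p (r *\<^sub>R x) = r * p x"
  proof (cases "r = 0")
    case False
    with \<open>r \<ge> 0\<close> have r: "r > 0" by simp
    have "p ((1 / r) *\<^sub>R (r *\<^sub>R x)) \<le> (1 / r) * p (r *\<^sub>R x)"
      using r by (intro scale) simp
    then have "r * p x \<le> p (r *\<^sub>R x)"
      using r by (simp add: field_simps)
    with scale[OF r, of x] show ?thesis by simp
  qed (simp add: zero)
qed (rule add)

lemma sublinear_add: "sublinear p \<Longrightarrow> p (x + y) \<le> p x + p y"
  by (simp add: sublinear_def)

lemma sublinear_scale: "sublinear p \<Longrightarrow> r \<ge> 0 \<Longrightarrow> p (r *\<^sub>R x) = r * p x"
  by (simp add: sublinear_def)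

lemma sublinear_zero: "sublinear p \<Longrightarrow> p 0 = 0"
  using sublinear_scale[of p 0 0] by simp

lemma sublinear_minus_le: "sublinear p \<Longrightarrow> - p (- x) \<le> p x"
  using sublinear_add[of p x "- x"] sublinear_zero[of p] by simp

text \<open>\<open>tilt p a\<close> is sublinear and at most \<open>p\<close>. A minimal sublinear \<open>u\<close> therefore equals \<open>tilt u a\<close> for
  every \<open>a\<close>, which makes it additive: this replaces the usual extension argument for Hahn-Banach.\<close>

definition tilt :: "('v::real_vector \<Rightarrow> real) \<Rightarrow> 'v \<Rightarrow> 'v \<Rightarrow> real"
  where "tilt p a x = (INF t\<in>{0..}. p (x + t *\<^sub>R a) - t * p a)"

lemma tilt_le:
  assumes "sublinear p" "t \<ge> 0"
  shows "tilt p a x \<le> p (x + t *\<^sub>R a) - t * p a"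
  unfolding tilt_def
proof (rule cINF_lower)
  have "- p (- x) \<le> p (x + t *\<^sub>R a) - t * p a" if "t \<ge> 0" for t
    using sublinear_add[OF assms(1), of "x + t *\<^sub>R a" "- x"] sublinear_scale[OF assms(1) that, of a]
    by simp
  then show "bdd_below ((\<lambda>t. p (x + t *\<^sub>R a) - t * p a) ` {0..})"
    by (auto intro!: bdd_belowI2)
qed (use assms in auto)

lemma tilt_ge:
  assumes "\<And>t. t \<ge> 0 \<Longrightarrow> c \<le> p (x + t *\<^sub>R a) - t * p a"
  shows "c \<le> tilt p a x"
  unfolding tilt_def by (rule cINF_greatest) (use assms in auto)

lemma sublinear_tilt:
  assumes "sublinear p" shows "sublinear (tilt p a)"
proof (rule sublinearI)
  fix x y
  have "tilt p a (x + y) \<le> (p (x + t *\<^sub>R a) - t * p a) + (p (y + s *\<^sub>R a) - s * p a)"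
    if "t \<ge> 0" "s \<ge> 0" for t s :: real
  proof -
    have "tilt p a (x + y) \<le> p ((x + t *\<^sub>R a) + (y + s *\<^sub>R a)) - (t + s) * p a"
      using tilt_le[OF assms, of "t + s" a "x + y"] that by (simp add: algebra_simps)
    also have "\<dots> \<le> (p (x + t *\<^sub>R a) - t * p a) + (p (y + s *\<^sub>R a) - s * p a)"
      using sublinear_add[OF assms, of "x + t *\<^sub>R a" "y + s *\<^sub>R a"] by (simp add: algebra_simps)
    finally show ?thesis .
  qed
  \<comment> \<open>The two infima are taken one after the other: first over \<open>s\<close>, then
    over \<open>t\<close>.\<close>
  then have "tilt p a (x + y) - (p (x + t *\<^sub>R a) - t * p a) \<le> tilt p a y" if "t \<ge> 0" for t
    using that by (intro tilt_ge) (simp only: diff_le_eq add.commute)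
  then have "tilt p a (x + y) - tilt p a y \<le> tilt p a x"
    by (intro tilt_ge) (simp add: algebra_simps)
  then show "tilt p a (x + y) \<le> tilt p a x + tilt p a y" by simp
next
  fix r :: real and x assume r: "r > 0"
  have "tilt p a (r *\<^sub>R x) / r \<le> tilt p a x"
  proof (rule tilt_ge)
    fix t :: real assume t: "t \<ge> 0"
    have "tilt p a (r *\<^sub>R x) \<le> p (r *\<^sub>R x + (r * t) *\<^sub>R a) - (r * t) * p a"
      by (rule tilt_le) (use assms r t in auto)
    also have "r *\<^sub>R x + (r * t) *\<^sub>R a = r *\<^sub>R (x + t *\<^sub>R a)" by (simp add: algebra_simps)
    also have "p \<dots> = r * p (x + t *\<^sub>R a)" using assms r unfolding sublinear_def by simp
    finally show "tilt p a (r *\<^sub>R x) / r \<le> p (x + t *\<^sub>R a) - t * p a"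
      using r by (simp add: field_simps)
  qed
  then show "tilt p a (r *\<^sub>R x) \<le> r * tilt p a x" using r by (simp add: field_simps)
next
  show "tilt p a 0 = 0"
  proof (rule antisym)
    show "tilt p a 0 \<le> 0" using tilt_le[OF assms, of 0 a 0] sublinear_zero[OF assms] by simp
    show "0 \<le> tilt p a 0"
      by (rule tilt_ge) (use assms in \<open>simp add: sublinear_def\<close>)
  qed
qed

lemma sublinear_dominates_linear:
  fixes p :: "'v::real_vector \<Rightarrow> real"
  assumes p: "sublinear p"
  obtains u where "linear u" "\<And>x. u x \<le> p x"
proof -
  define Q where "Q = {q. sublinear q \<and> (\<forall>x. q x \<le> p x)}"
  \<comment> \<open>The order is reversed, so that a maximal element in Zorn's lemma is a pointwise
    minimal functional.\<close>
  define P where "P = (\<lambda>q r :: 'v \<Rightarrow> real. \<forall>x. r x \<le> q x)"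
  have "\<exists>m\<in>Q. \<forall>a\<in>Q. P m a \<longrightarrow> a = m"
  proof (rule predicate_Zorn)
    show "partial_order_on Q (relation_of P Q)"
      unfolding P_def by (rule partial_order_on_relation_ofI) (auto intro: order_trans intro!: ext antisym)
  next
    fix C assume "C \<in> Chains (relation_of P Q)"
    then have sub: "C \<subseteq> Q" and total: "\<And>q r. q \<in> C \<Longrightarrow> r \<in> C \<Longrightarrow> P q r \<or> P r q"
      by (auto simp: Chains_def relation_of_def)
    show "\<exists>u\<in>Q. \<forall>a\<in>C. P a u"
    proof (cases "C = {}")
      case True
      then show ?thesis using p by (auto simp: Q_def)
    next
      case False
      define u where "u = (\<lambda>x. INF q\<in>C. q x)"
      \<comment> \<open>This bound is common to all sublinear functionals below \<open>p\<close>; it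
        keeps the infimum over a chain finite.\<close>
      have "- p (- x) \<le> q x" if "q \<in> C" for q x
        proof -
        have "q (- x) \<le> p (- x)" "- q (- x) \<le> q x"
          using that sub sublinear_minus_le unfolding Q_def by auto
        then show ?thesis by simp
      qed
      then have bdd: "bdd_below ((\<lambda>q. q x) ` C)" for x by (auto intro!: bdd_belowI2)
      have le: "u x \<le> q x" if "q \<in> C" for q x
        unfolding u_def using bdd that by (rule cINF_lower)
      have ge: "c \<le> u x" if "\<And>q. q \<in> C \<Longrightarrow> c \<le> q x" for c x
        unfolding u_def using False that by (rule cINF_greatest)
      have "sublinear u"
      proof (rule sublinearI)
        fix x y
        have "u (x + y) \<le> q x + r y" if qr: "q \<in> C" "r \<in> C" for q r
        proof -
          \<comment> \<open>In a chain the smaller of \<open>q\<close> and \<open>r\<close> can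
            replace both of them.\<close>
          obtain w where w: "w \<in> C" "w x \<le> q x" "w y \<le> r y"
            using total[OF qr] qr unfolding P_def by blast
          have "u (x + y) \<le> w (x + y)" using w by (intro le)
          also have "\<dots> \<le> w x + w y" using w sub by (auto simp: Q_def sublinear_def)
          finally show ?thesis using w by simp
        qed
        note bound = this
        have "u (x + y) - q x \<le> u y" if "q \<in> C" for q
        proof (rule ge)
          fix r assume "r \<in> C"
          from bound[OF that this] show "u (x + y) - q x \<le> r y" by simp
        qed
        then have "u (x + y) - u y \<le> u x"
          by (intro ge) (simp add: algebra_simps)
        then show "u (x + y) \<le> u x + u y" by simp
      next
        fix r :: real and x assume r: "r > 0"
        have "u (r *\<^sub>R x) / r \<le> u x"
        proof (rule ge)
          fix q assume q: "q \<in> C"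
          then have "u (r *\<^sub>R x) \<le> r * q x"
            using le[OF q, of "r *\<^sub>R x"] sub r by (auto simp: Q_def sublinear_def)
          then show "u (r *\<^sub>R x) / r \<le> q x" using r by (simp add: field_simps)
        qed
        then show "u (r *\<^sub>R x) \<le> r * u x" using r by (simp add: field_simps)
      next
        have z: "q 0 = 0" if "q \<in> C" for q using that sub sublinear_zero by (auto simp: Q_def)
        obtain q where "q \<in> C" using False by blast
        then show "u 0 = 0" using le[of q 0] ge[of 0 0] z by force
      qed
      moreover have "u x \<le> p x" for x
      proof -
        obtain q where "q \<in> C" using False by blast
        then have "u x \<le> q x" "q x \<le> p x" using le sub unfolding Q_def by auto
        then show ?thesis by simp
      qed
      ultimately have "u \<in> Q" by (simp add: Q_def)
      then show ?thesis using le unfolding P_def by blast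
    qed
  qed
  then obtain u where u: "u \<in> Q" and min: "\<And>q. q \<in> Q \<Longrightarrow> P u q \<Longrightarrow> q = u" by blast
  have sub: "sublinear u" using u by (simp add: Q_def)
  have tilt_u: "tilt u a = u" for a
  proof -
    have *: "tilt u a x \<le> u x" for x using tilt_le[OF sub, of 0 a x] by simp
    with u have "tilt u a \<in> Q"
      unfolding Q_def using sublinear_tilt[OF sub] by (auto intro: order_trans)
    then show ?thesis using min * unfolding P_def by blast
  qed
  have add: "u (x + a) = u x + u a" for x a
  proof (rule antisym)
    show "u (x + a) \<le> u x + u a" using sub by (simp add: sublinear_def)
    \<comment> \<open>The choice \<open>t = 1\<close> in the infimum that defines
      \<open>tilt u a x\<close>, which equals \<open>u x\<close>.\<close>
    show "u x + u a \<le> u (x + a)" using tilt_le[OF sub, of 1 a x] tilt_u[of a] by simp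
  qed
  have neg: "u (- x) = - u x" for x using add[of x "- x"] sublinear_zero[OF sub] by simp
  have "u (r *\<^sub>R x) = r * u x" for r x
  proof (cases "r \<ge> 0")
    case False
    then have "u ((- r) *\<^sub>R x) = - r * u x" using sub by (simp add: sublinear_def del: scaleR_minus_left)
    then show ?thesis using neg[of "r *\<^sub>R x"] by simp
  qed (use sub in \<open>simp add: sublinear_def\<close>)
  then have "linear u" using add by (intro linearI) auto
  moreover have "u x \<le> p x" for x using u by (simp add: Q_def)
  ultimately show ?thesis using that by blast
qed

text \<open>Dominating by \<open>tilt p a\<close> instead of \<open>p\<close> forces equality at
  \<open>a\<close>: the value of \<open>tilt p a\<close> at \<open>- a\<close> is at most
  \<open>- p a\<close>, as \<open>t = 1\<close> shows, so \<open>u a\<close> is at least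
  \<open>p a\<close>.\<close>

lemma sublinear_dominates_linear_attaining:
  fixes p :: "'v::real_vector \<Rightarrow> real"
  assumes p: "sublinear p"
  obtains u where "linear u" "\<And>x. u x \<le> p x" "u a = p a"
proof -
  obtain u where u: "linear u" "\<And>x. u x \<le> tilt p a x"
    using sublinear_dominates_linear[OF sublinear_tilt[OF p]] by blast
  have le: "u x \<le> p x" for x
    using u(2)[of x] tilt_le[OF p, of 0 a x] by simp
  have "u (- a) \<le> - p a"
    using u(2)[of "- a"] tilt_le[OF p, of 1 a "- a"] sublinear_zero[OF p] by simp
  then have "u a = p a" using le[of a] linear_neg[OF u(1)] by (intro antisym) auto
  then show ?thesis using u(1) le that by blast
qed

lemma sublinear_norm: "sublinear norm"
  by (simp add: sublinear_def norm_triangle_ineq)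

lemma linear_le_norm_bounded_linear:
  fixes u :: "'v::real_normed_vector \<Rightarrow> real"
  assumes "linear u" "\<And>x. u x \<le> norm x * K"
  shows "bounded_linear u"
proof -
  have "norm (u x) \<le> norm x * K" for x
    using assms(2)[of x] assms(2)[of "- x"] linear_neg[OF assms(1)] by (simp add: abs_le_iff)
  then show ?thesis
    using assms(1) by (intro bounded_linear_intro[of _ K]) (auto simp: linear_add linear_scale)
qed

lemma functional_separates_points:
  fixes x :: "'v::real_normed_vector"
  assumes "\<And>g :: 'v \<Rightarrow>\<^sub>L real. g x = g y"
  shows "x = y"
proof -
  obtain u where u: "linear u" "\<And>z. u z \<le> norm z" "u (x - y) = norm (x - y)"
    using sublinear_dominates_linear_attaining[OF sublinear_norm] by blast
  then have bl: "bounded_linear u"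
    using linear_le_norm_bounded_linear[of u 1] by simp
  have "u x = u y" using assms[of "Blinfun u"] by (simp add: bounded_linear_Blinfun_apply[OF bl])
  then show ?thesis using u(3) linear_diff[OF u(1)] by simp
qed

text \<open>The distance to a subspace is sublinear, at most the norm, zero on \<open>D\<close> and
  positive at \<open>a\<close>. A linear functional below it is nonpositive at \<open>x\<close> and
  at \<open>- x\<close> for \<open>x\<close> in \<open>D\<close>, hence zero there.\<close>

lemma functional_separates_subspace:
  fixes D :: "'v::real_normed_vector set"
  assumes D: "subspace D" and a: "a \<notin> closure D"
  obtains u :: "'v \<Rightarrow>\<^sub>L real" where "\<And>x. x \<in> D \<Longrightarrow> u x = 0" "u a \<noteq> 0"
proof -
  have ne: "D \<noteq> {}" and 0: "0 \<in> D" using D subspace_0 by auto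
  define p where "p = (\<lambda>x. infdist x D)"
  have p0: "p x = 0" if "x \<in> D" for x using that by (simp add: p_def)
  have le: "p x \<le> norm (x - d)" if "d \<in> D" for x d
    unfolding p_def using infdist_le[OF that] by (simp add: dist_norm)
  have ge: "c \<le> p x" if "\<And>d. d \<in> D \<Longrightarrow> c \<le> norm (x - d)" for c x
    unfolding p_def infdist_notempty[OF ne] using ne that by (intro cINF_greatest) (auto simp: dist_norm)
  have "sublinear p"
  proof (rule sublinearI)
    fix x y
    have "p (x + y) \<le> norm (x - d) + norm (y - e)" if "d \<in> D" "e \<in> D" for d e
    proof -
      have "p (x + y) \<le> norm ((x + y) - (d + e))" using that D by (intro le subspace_add)
      also have "\<dots> \<le> norm (x - d) + norm (y - e)"
        by (metis add_diff_add norm_triangle_ineq)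
      finally show ?thesis .
    qed
    then have "p (x + y) - norm (x - d) \<le> p y" if "d \<in> D" for d
      using that by (intro ge) (simp add: algebra_simps)
    then have "p (x + y) - p y \<le> p x" by (intro ge) (simp add: algebra_simps)
    then show "p (x + y) \<le> p x + p y" by simp
  next
    fix r :: real and x assume r: "r > 0"
    have "p (r *\<^sub>R x) / r \<le> p x"
    proof (rule ge)
      fix d assume d: "d \<in> D"
      have "p (r *\<^sub>R x) \<le> norm (r *\<^sub>R x - r *\<^sub>R d)" using d D by (intro le subspace_scale)
      also have "\<dots> = r * norm (x - d)" using r by (simp add: scaleR_diff_right[symmetric])
      finally show "p (r *\<^sub>R x) / r \<le> norm (x - d)" using r by (simp add: field_simps)
    qed
    then show "p (r *\<^sub>R x) \<le> r * p x" using r by (simp add: field_simps)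
  qed (simp add: p0 0)
  then obtain u where u: "linear u" "\<And>x. u x \<le> p x" "u a = p a"
    using sublinear_dominates_linear_attaining[of p a] by blast
  have "u x \<le> norm x * 1" for x using u(2)[of x] le[OF 0, of x] by simp
  with u(1) have bl: "bounded_linear u" by (rule linear_le_norm_bounded_linear)
  show ?thesis
  proof
    fix x assume "x \<in> D"
    then have "u x \<le> 0" "u (- x) \<le> 0"
      using u(2)[of x] u(2)[of "- x"] p0 D subspace_neg by (metis, metis)
    then show "Blinfun u x = 0"
      using linear_neg[OF u(1)] by (simp add: bounded_linear_Blinfun_apply[OF bl])
  next
    have "p a \<noteq> 0" using a ne in_closure_iff_infdist_zero unfolding p_def by blast
    then show "Blinfun u a \<noteq> 0" using u(3) by (simp add: bounded_linear_Blinfun_apply[OF bl])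
  qed
qed

text \<open>A Banach limit that takes the place of a weakly convergent subsequence. The dominating
  functional \<open>p g\<close> is the limes superior of the values \<open>g (x n)\<close>, written
  as the infimum of their eventual upper bounds.\<close>

lemma generalized_limit:
  fixes x :: "nat \<Rightarrow> 'v::real_normed_vector"
  assumes bound: "\<And>n. norm (x n) \<le> K"
  obtains \<psi> :: "('v \<Rightarrow>\<^sub>L real) \<Rightarrow> real"
  where "bounded_linear \<psi>" "\<And>g l. (\<lambda>n. blinfun_apply g (x n)) \<longlonglongrightarrow> l \<Longrightarrow> \<psi> g = l"
proof -
  define C where "C = (\<lambda>g :: 'v \<Rightarrow>\<^sub>L real. {c. \<forall>\<^sub>F n in sequentially. g (x n) \<le> c})"
  define p where "p = (\<lambda>g. Inf (C g))"
  have bd: "\<bar>blinfun_apply g (x n)\<bar> \<le> norm g * K" for g n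
  proof -
    have "norm (blinfun_apply g (x n)) \<le> norm g * norm (x n)" by (rule norm_blinfun)
    also have "\<dots> \<le> norm g * K" using bound by (intro mult_left_mono) auto
    finally show ?thesis by simp
  qed
  have ne: "norm g * K \<in> C g" for g
    unfolding C_def using bd[of g] by (auto simp: abs_le_iff)
  have low: "- (norm g * K) \<le> c" if "c \<in> C g" for c g
  proof -
    have "\<exists>n. g (x n) \<le> c"
      using that unfolding C_def by (intro eventually_happens'[OF sequentially_bot]) simp
    then obtain n where "g (x n) \<le> c" ..
    then show ?thesis using bd[of g n] by simp
  qed
  have le: "p g \<le> c" if "c \<in> C g" for c g
    unfolding p_def using that low by (intro cInf_lower bdd_belowI) auto
  have ge: "b \<le> p g" if "\<And>c. c \<in> C g \<Longrightarrow> b \<le> c" for b g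
    unfolding p_def using that ne by (intro cInf_greatest) auto
  have "sublinear p"
  proof (rule sublinearI)
    fix f g
    have "c + d \<in> C (f + g)" if "c \<in> C f" "d \<in> C g" for c d
      using that unfolding C_def
      by (auto simp: blinfun.add_left elim: eventually_elim2)
    note sum = this
    have "p (f + g) - c \<le> p g" if "c \<in> C f" for c
    proof (rule ge)
      fix d assume "d \<in> C g"
      from le[OF sum[OF that this]] show "p (f + g) - c \<le> d" by simp
    qed
    then have "p (f + g) - p g \<le> p f" by (intro ge) (simp add: algebra_simps)
    then show "p (f + g) \<le> p f + p g" by simp
  next
    fix r :: real and f assume r: "r > 0"
    have "p (r *\<^sub>R f) / r \<le> p f"
    proof (rule ge)
      fix c assume "c \<in> C f"
      then have "r * c \<in> C (r *\<^sub>R f)"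
        unfolding C_def using r by (auto simp: blinfun.scaleR_left)
      then show "p (r *\<^sub>R f) / r \<le> c" using le r by (simp add: field_simps)
    qed
    then show "p (r *\<^sub>R f) \<le> r * p f" using r by (simp add: field_simps)
  next
    show "p 0 = 0" using le[OF ne[of 0]] ge[of 0 0] low[of _ 0] by (intro antisym) auto
  qed
  then obtain \<psi> where \<psi>: "linear \<psi>" "\<And>g. \<psi> g \<le> p g"
    using sublinear_dominates_linear by blast
  have upper: "\<psi> g \<le> l" if "(\<lambda>n. blinfun_apply g (x n)) \<longlonglongrightarrow> l" for g l
  proof (rule field_le_epsilon)
    fix e :: real assume "e > 0"
    then have "\<forall>\<^sub>F n in sequentially. g (x n) < l + e"
      using that by (intro order_tendstoD(2)[where a = "l + e"]) auto
    then have "l + e \<in> C g" unfolding C_def by (auto elim: eventually_mono)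
    then show "\<psi> g \<le> l + e" using \<psi>(2) le order_trans by blast
  qed
  show ?thesis
  proof
    show "bounded_linear \<psi>"
      using \<psi>(1) by (rule linear_le_norm_bounded_linear[where K = K]) (use \<psi>(2) le ne order_trans in blast)
  next
    fix g :: "'v \<Rightarrow>\<^sub>L real" and l assume lim: "(\<lambda>n. blinfun_apply g (x n)) \<longlonglongrightarrow> l"
    have "\<psi> (- g) \<le> - l"
      using lim by (intro upper) (auto simp: blinfun.minus_left intro: tendsto_minus)
    then show "\<psi> g = l" using upper[OF lim] linear_neg[OF \<psi>(1), of g] by simp
  qed
qed

section \<open>Complex structure and reflexivity\<close>

lemma scaleC_scaleR_commute: "c *\<^sub>C r *\<^sub>R x = r *\<^sub>R c *\<^sub>C x"
  unfolding scaleC_of_real[symmetric] scaleC_scaleC by (simp add: mult.commute)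

lemma bounded_clinear_alt:
  "bounded_clinear f \<longleftrightarrow> bounded_linear f \<and> (\<forall>x. f (\<i> *\<^sub>C x) = \<i> *\<^sub>C f x)"
proof
  assume f: "bounded_linear f \<and> (\<forall>x. f (\<i> *\<^sub>C x) = \<i> *\<^sub>C f x)"
  then interpret bounded_linear f by simp
  have expand: "c *\<^sub>C x = Re c *\<^sub>R x + Im c *\<^sub>R (\<i> *\<^sub>C x)" for c and x :: "'c::complex_normed_vector"
    by (metis complex_eq mult.commute scaleC_add_left scaleC_of_real scaleC_scaleC)
  have "f (c *\<^sub>C x) = c *\<^sub>C f x" for c x
    using f by (simp add: expand[of c] add scaleR)
  then show "bounded_clinear f" using f by (simp add: bounded_clinear_def)
qed (simp add: bounded_clinear_def)

text \<open>Passes from real functionals, which Hahn-Banach delivers, to the complex dual in which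
  reflexivity is stated. The complex extension of \<psi> takes \<open>f\<close> to \<psi> of its
  real part minus \<i> times \<psi> of the real part of \<i> times \<open>f\<close>; conversely each
  real \<open>u\<close> is the real part of the complex functional with imaginary part
  \<open>- u (\<i> *\<^sub>C x)\<close>.\<close>

lemma reflexive_space_real_bidual:
  fixes \<psi> :: "('a::complex_normed_vector \<Rightarrow>\<^sub>L real) \<Rightarrow> real"
  assumes refl: "reflexive_space TYPE('a)" and \<psi>: "bounded_linear \<psi>"
  obtains x where "\<And>u. \<psi> u = blinfun_apply u x"
proof -
  interpret \<psi>: bounded_linear \<psi> by fact
  define re where "re = (\<lambda>f :: 'a \<Rightarrow> complex. Blinfun (\<lambda>x. Re (f x)))"
  define \<phi> where "\<phi> = (\<lambda>f. Complex (\<psi> (re f)) (- \<psi> (re (\<lambda>x. \<i> * f x))))"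
  have re: "re f x = Re (f x)" if "bounded_clinear f" for f x
  proof -
    have "bounded_linear (\<lambda>x. Re (f x))"
      using that unfolding bounded_clinear_def
      by (intro bounded_linear_compose[OF bounded_linear_Re]) auto
    then show ?thesis unfolding re_def by (simp add: bounded_linear_Blinfun_apply)
  qed
  have norm_re: "norm (re f) \<le> onorm f" if "bounded_clinear f" for f
  proof (rule norm_blinfun_bound)
    have bl: "bounded_linear f" using that by (simp add: bounded_clinear_def)
    show "0 \<le> onorm f" using bl by (rule onorm_pos_le)
    show "norm (re f x) \<le> onorm f * norm x" for x
      using onorm[OF bl, of x] abs_Re_le_cmod[of "f x"] by (simp add: re[OF that])
  qed
  have comb: "bounded_clinear (\<lambda>x. f x + c * g x)"
    if "bounded_clinear f" "bounded_clinear g" for f g :: "'a \<Rightarrow> complex" and c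
    using that unfolding bounded_clinear_def scaleC_complex_def
    by (auto intro!: bounded_linear_add bounded_linear_const_mult simp: algebra_simps)
  have scale: "bounded_clinear (\<lambda>x. c * g x)"
    if "bounded_clinear g" for g :: "'a \<Rightarrow> complex" and c
    using that unfolding bounded_clinear_def scaleC_complex_def
    by (auto intro!: bounded_linear_const_mult simp: algebra_simps)
  have re_comb: "re (\<lambda>x. f x + c * g x) = re f + Re c *\<^sub>R re g + Im c *\<^sub>R re (\<lambda>x. \<i> * g x)"
    if "bounded_clinear f" "bounded_clinear g" for f g c
    by (rule blinfun_eqI)
      (simp add: re comb scale that blinfun.add_left blinfun.scaleR_left)
  have "\<phi> \<in> cbidual"
    unfolding cbidual_def mem_Collect_eq
  proof (intro conjI ballI allI exI)
    fix f g :: "'a \<Rightarrow> complex" and c assume "f \<in> cdual" "g \<in> cdual"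
    then have f: "bounded_clinear f" and g: "bounded_clinear g" by (auto simp: cdual_def)
    have "re (\<lambda>x. \<i> * (f x + c * g x)) =
        re (\<lambda>x. \<i> * f x) + Re c *\<^sub>R re (\<lambda>x. \<i> * g x) - Im c *\<^sub>R re g"
      by (rule blinfun_eqI)
        (simp add: re comb scale f g blinfun.add_left blinfun.diff_left blinfun.scaleR_left algebra_simps)
    note re_i_comb = this
    show "\<phi> (\<lambda>x. f x + c * g x) = \<phi> f + c * \<phi> g"
      unfolding \<phi>_def re_comb[OF f g] re_i_comb
      by (simp add: complex_eq_iff \<psi>.add \<psi>.diff \<psi>.scaleR algebra_simps)
  next
    fix f :: "'a \<Rightarrow> complex" assume "f \<in> cdual"
    then have f: "bounded_clinear f" by (simp add: cdual_def)
    have bl: "bounded_linear f" using f by (simp add: bounded_clinear_def)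
    have "norm (re (\<lambda>x. \<i> * f x)) \<le> onorm (\<lambda>x. \<i> * f x)" by (rule norm_re[OF scale[OF f]])
    also have "\<dots> \<le> onorm f"
      using onorm[OF bl] by (intro onorm_bound onorm_pos_le[OF bl]) (simp add: norm_mult)
    finally have 2: "norm (re (\<lambda>x. \<i> * f x)) \<le> onorm f" .
    have "cmod (\<phi> f) \<le> norm (\<psi> (re f)) + norm (\<psi> (re (\<lambda>x. \<i> * f x)))"
      unfolding \<phi>_def using cmod_le[of "Complex (\<psi> (re f)) (- \<psi> (re (\<lambda>x. \<i> * f x)))"] by simp
    also have "\<dots> \<le> onorm \<psi> * norm (re f) + onorm \<psi> * norm (re (\<lambda>x. \<i> * f x))"
      by (intro add_mono onorm \<psi>)
    also have "\<dots> \<le> onorm \<psi> * onorm f + onorm \<psi> * onorm f"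
      by (intro add_mono mult_left_mono 2 norm_re f onorm_pos_le \<psi>)
    finally show "cmod (\<phi> f) \<le> (2 * onorm \<psi>) * onorm f" by (simp add: mult_ac)
  qed
  then obtain x where x: "\<And>f. f \<in> cdual \<Longrightarrow> \<phi> f = f x"
    using refl unfolding reflexive_space_def by blast
  have "\<psi> u = u x" for u
  proof -
    define f where "f = (\<lambda>x. Complex (u x) (- u (\<i> *\<^sub>C x)))"
    have ii: "\<i> *\<^sub>C \<i> *\<^sub>C z = - z" for z :: 'a
      using scaleC_of_real[of "-1" z] by (simp add: scaleC_scaleC)
    have lin: "linear f"
      by (rule linearI)
        (auto simp: f_def complex_eq_iff blinfun.add_right blinfun.scaleR_right scaleC_add_right
          scaleC_scaleR_commute)
    have "norm (f z) \<le> norm z * (2 * norm u)" for z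
    proof -
      have "cmod (f z) \<le> norm (u z) + norm (u (\<i> *\<^sub>C z))"
        unfolding f_def using cmod_le[of "Complex (u z) (- u (\<i> *\<^sub>C z))"] by simp
      also have "\<dots> \<le> norm u * norm z + norm u * norm (\<i> *\<^sub>C z)"
        by (intro add_mono norm_blinfun)
      finally show ?thesis by (simp add: norm_scaleC)
    qed
    then have "bounded_linear f"
      using lin by (intro bounded_linear_intro) (auto simp: linear_add linear_scale)
    then have bc: "bounded_clinear f"
      by (simp add: bounded_clinear_alt scaleC_complex_def f_def complex_eq_iff ii blinfun.minus_right)
    then have "\<phi> f = f x" by (intro x) (simp add: cdual_def)
    then have "\<psi> (re f) = u x" by (simp add: \<phi>_def f_def)
    moreover have "re f = u" by (rule blinfun_eqI) (simp add: re[OF bc], simp add: f_def)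
    ultimately show ?thesis by simp
  qed
  then show ?thesis by (rule that)
qed

lemma linear_operatorD:
  assumes "linear_operator D A"
  shows "0 \<in> D" "x \<in> D \<Longrightarrow> y \<in> D \<Longrightarrow> x + y \<in> D" "x \<in> D \<Longrightarrow> y \<in> D \<Longrightarrow> x - y \<in> D"
    "x \<in> D \<Longrightarrow> c *\<^sub>C x \<in> D" "x \<in> D \<Longrightarrow> r *\<^sub>R x \<in> D" "subspace D"
    "x \<in> D \<Longrightarrow> y \<in> D \<Longrightarrow> A (x + y) = A x + A y"
    "x \<in> D \<Longrightarrow> y \<in> D \<Longrightarrow> A (x - y) = A x - A y"
    "x \<in> D \<Longrightarrow> A (c *\<^sub>C x) = c *\<^sub>C A x" "x \<in> D \<Longrightarrow> A (r *\<^sub>R x) = r *\<^sub>R A x"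
proof -
  interpret C: vector_space "scaleC :: complex \<Rightarrow> 'a \<Rightarrow> 'a" by (rule vector_space_scaleC)
  interpret C2: vector_space "scaleC :: complex \<Rightarrow> 'b \<Rightarrow> 'b" by (rule vector_space_scaleC)
  have sub: "C.subspace D" and lin: "\<And>x y c. x \<in> D \<Longrightarrow> y \<in> D \<Longrightarrow> A (x + c *\<^sub>C y) = A x + c *\<^sub>C A y"
    using assms by (auto simp: linear_operator_def)
  show 0: "0 \<in> D" using sub by (rule C.subspace_0)
  show add: "x + y \<in> D" if "x \<in> D" "y \<in> D" for x y using sub that by (rule C.subspace_add)
  show "x - y \<in> D" if "x \<in> D" "y \<in> D" for x y using sub that by (rule C.subspace_diff)
  show scale: "c *\<^sub>C x \<in> D" if "x \<in> D" for x c using sub that by (rule C.subspace_scale)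
  show scaleR: "r *\<^sub>R x \<in> D" if "x \<in> D" for x r using scale[OF that, of "complex_of_real r"] by (simp add: scaleC_of_real)
  show "subspace D" using 0 add scaleR by (auto simp: subspace_def)
  show Aadd: "A (x + y) = A x + A y" if "x \<in> D" "y \<in> D" for x y using lin[OF that, of 1] by simp
  show "A (x - y) = A x - A y" if "x \<in> D" "y \<in> D" for x y using lin[OF that, of "-1"] by simp
  have "A 0 = 0" using Aadd[OF 0 0] by simp
  then show Ascale: "A (c *\<^sub>C x) = c *\<^sub>C A x" if "x \<in> D" for x c using lin[OF 0 that] by simp
  show "A (r *\<^sub>R x) = r *\<^sub>R A x" if "x \<in> D" for x r
    using Ascale[OF that, of "complex_of_real r"] by (simp add: scaleC_of_real)
qed

lemma linear_operatorI:
  assumes "0 \<in> D" and "\<And>x y c. x \<in> D \<Longrightarrow> y \<in> D \<Longrightarrow> x + c *\<^sub>C y \<in> D"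
    and "\<And>x y c. x \<in> D \<Longrightarrow> y \<in> D \<Longrightarrow> A (x + c *\<^sub>C y) = A x + c *\<^sub>C A y"
  shows "linear_operator D A"
proof -
  interpret C: vector_space "scaleC :: complex \<Rightarrow> 'a \<Rightarrow> 'a" by (rule vector_space_scaleC)
  have "C.subspace D"
  proof (rule C.subspaceI)
    show "x + y \<in> D" if "x \<in> D" "y \<in> D" for x y using assms(2)[OF that, of 1] by simp
    show "c *\<^sub>C x \<in> D" if "x \<in> D" for c x using assms(2)[OF assms(1) that, of c] by simp
  qed fact
  then show ?thesis using assms(3) by (simp add: linear_operator_def)
qed

section \<open>The Lumer-Phillips theorem\<close>

lemma scaleC_diff_right: "c *\<^sub>C (x - y) = c *\<^sub>C x - c *\<^sub>C y"
  using scaleC_add_right[of c "x - y" y] by (simp add: algebra_simps)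

section \<open>Powers, limits and telescoping of nonexpansive linear maps\<close>

lemma funpow_commute: "(f ^^ n) \<circ> g = g \<circ> (f ^^ n)" if "f \<circ> g = g \<circ> f"
proof (induction n)
  case (Suc n)
  have "(f ^^ Suc n) \<circ> g = f \<circ> (g \<circ> f ^^ n)" by (simp only: funpow.simps comp_assoc Suc)
  also have "\<dots> = g \<circ> (f ^^ Suc n)" using that by (metis comp_assoc funpow.simps(2))
  finally show ?case .
qed simp

lemma funpow_comp: "((f \<circ> g) ^^ n) = (f ^^ n) \<circ> (g ^^ n)" if "f \<circ> g = g \<circ> f"
proof (induction n)
  case (Suc n)
  have "(f \<circ> g) ^^ Suc n = f \<circ> (g \<circ> f ^^ n) \<circ> (g ^^ n)" by (simp only: funpow.simps Suc comp_assoc)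
  also have "g \<circ> f ^^ n = f ^^ n \<circ> g" using funpow_commute[OF that] by simp
  finally show ?case by (simp only: funpow.simps comp_assoc)
qed simp

lemma norm_add_diff_le: "norm (a + b - c) \<le> norm a + norm b + norm (c :: 'a::real_normed_vector)"
  using norm_triangle_ineq4[of "a + b" c] norm_triangle_ineq[of a b] by linarith

lemma norm_divideR_le: "norm (x /\<^sub>R h) \<le> c" if "h > 0" "norm x \<le> h * c"
  for x :: "'a::real_normed_vector"
  using that by (simp add: field_simps)

text \<open>Operator norm at most 1, stated pointwise because this form passes directly to
  compositions, powers and pointwise limits.\<close>

definition nonexpansive_clinear :: "('a::complex_normed_vector \<Rightarrow> 'a) \<Rightarrow> bool"
  where "nonexpansive_clinear f \<longleftrightarrow> bounded_clinear f \<and> (\<forall>x. norm (f x) \<le> norm x)"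

lemma nonexpansive_clinearD:
  assumes "nonexpansive_clinear f"
  shows "bounded_linear f" "f (x + y) = f x + f y" "f (x - y) = f x - f y"
    "f (r *\<^sub>R x) = r *\<^sub>R f x" "f (c *\<^sub>C x) = c *\<^sub>C f x" "norm (f x) \<le> norm x"
  using assms unfolding nonexpansive_clinear_def bounded_clinear_def
  by (auto simp: linear_simps)

lemma nonexpansive_clinearI:
  assumes "\<And>x y. f (x + y) = f x + f y" "\<And>c x. f (c *\<^sub>C x) = c *\<^sub>C f x" "\<And>x. norm (f x) \<le> norm x"
  shows "nonexpansive_clinear f"
proof -
  have "f (r *\<^sub>R x) = r *\<^sub>R f x" for r x
    using assms(2)[of "complex_of_real r" x] by (simp add: scaleC_of_real)
  then have "bounded_linear f" using assms by (intro bounded_linear_intro[of _ 1]) auto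
  then show ?thesis using assms by (simp add: nonexpansive_clinear_def bounded_clinear_def)
qed

lemma nonexpansive_clinear_id: "nonexpansive_clinear id"
  by (rule nonexpansive_clinearI) auto

lemma nonexpansive_clinear_comp:
  "nonexpansive_clinear f \<Longrightarrow> nonexpansive_clinear g \<Longrightarrow> nonexpansive_clinear (f \<circ> g)"
  by (rule nonexpansive_clinearI)
    (auto simp: nonexpansive_clinearD intro: order_trans nonexpansive_clinearD(6))

lemma nonexpansive_clinear_funpow: "nonexpansive_clinear f \<Longrightarrow> nonexpansive_clinear (f ^^ n)"
  by (induction n) (auto intro: nonexpansive_clinear_id[unfolded id_def] nonexpansive_clinear_id nonexpansive_clinear_comp)

lemma nonexpansive_clinear_lim:
  assumes "\<And>n. nonexpansive_clinear (E n)" "\<And>x. (\<lambda>n. E n x) \<longlonglongrightarrow> f x"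
  shows "nonexpansive_clinear f"
proof (rule nonexpansive_clinearI)
  fix x y
  have "(\<lambda>n. E n (x + y)) \<longlonglongrightarrow> f x + f y"
    using tendsto_add[OF assms(2)[of x] assms(2)[of y]] by (simp add: nonexpansive_clinearD[OF assms(1)])
  then show "f (x + y) = f x + f y" using LIMSEQ_unique assms(2) by blast
next
  fix c x
  interpret bounded_linear "scaleC c :: 'a \<Rightarrow> 'a"
    by (rule bounded_linear_intro[of _ "cmod c"])
      (auto simp: scaleC_add_right norm_scaleC scaleC_scaleR_commute)
  have "(\<lambda>n. E n (c *\<^sub>C x)) \<longlonglongrightarrow> c *\<^sub>C f x"
    using tendsto[OF assms(2)[of x]] by (simp add: nonexpansive_clinearD[OF assms(1)])
  then show "f (c *\<^sub>C x) = c *\<^sub>C f x" using LIMSEQ_unique assms(2) by blast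
next
  fix x
  show "norm (f x) \<le> norm x"
    by (rule Lim_norm_ubound[OF _ assms(2)]) (use nonexpansive_clinearD(6)[OF assms(1)] in auto)
qed

text \<open>Telescoping of the difference of powers. Commutation moves \<open>U - V\<close> to the
  innermost place, so that only its value at \<open>x\<close> enters and not an operator norm; this
  matters because one-step errors are small only at smooth points.\<close>

lemma norm_diff_funpow_le:
  assumes U: "nonexpansive_clinear U" and V: "nonexpansive_clinear V" and comm: "U \<circ> V = V \<circ> U"
  shows "norm ((U ^^ n) x - (V ^^ n) x) \<le> n * norm (U x - V x)"
proof (induction n)
  case (Suc n)
  have "(U ^^ n) (V x) = V ((U ^^ n) x)" using funpow_commute[OF comm, of n] by (metis comp_apply)
  then have "(U ^^ Suc n) x - (V ^^ Suc n) x = (U ^^ n) (U x - V x) + V ((U ^^ n) x - (V ^^ n) x)"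
    by (simp add: funpow_swap1 nonexpansive_clinearD[OF nonexpansive_clinear_funpow[OF U]] nonexpansive_clinearD[OF V])
  also have "norm \<dots> \<le> norm ((U ^^ n) (U x - V x)) + norm (V ((U ^^ n) x - (V ^^ n) x))"
    by (rule norm_triangle_ineq)
  also have "\<dots> \<le> norm (U x - V x) + norm ((U ^^ n) x - (V ^^ n) x)"
    by (intro add_mono nonexpansive_clinearD(6) V nonexpansive_clinear_funpow U)
  also have "\<dots> \<le> norm (U x - V x) + n * norm (U x - V x)" using Suc by simp
  finally show ?case by (simp add: algebra_simps)
qed simp

lemma convergent_if_convergent_on_dense:
  fixes x :: "'a::complex_banach"
  assumes E: "\<And>n. nonexpansive_clinear (E n)"
    and dense: "x \<in> closure Y" and conv: "\<And>y. y \<in> Y \<Longrightarrow> convergent (\<lambda>n. E n y)"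
  shows "convergent (\<lambda>n. E n x)"
proof (rule Cauchy_convergent, rule CauchyI)
  fix e :: real assume "e > 0"
  then have e3: "e / 3 > 0" by simp
  then obtain y where y: "y \<in> Y" "dist y x < e / 3" using dense closure_approachable by blast
  obtain N where N: "\<And>m n. m \<ge> N \<Longrightarrow> n \<ge> N \<Longrightarrow> norm (E m y - E n y) < e / 3"
    using convergent_Cauchy[OF conv[OF y(1)]] e3 unfolding Cauchy_iff by blast
  have "norm (E m x - E n x) < e" if "m \<ge> N" "n \<ge> N" for m n
  proof -
    have "E m x - E n x = E m (x - y) + (E m y - E n y) - E n (x - y)"
      by (simp add: nonexpansive_clinearD[OF E])
    also have "norm \<dots> \<le> norm (E m (x - y)) + norm (E m y - E n y) + norm (E n (x - y))"
      by (rule norm_add_diff_le)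
    also have "\<dots> \<le> norm (x - y) + norm (E m y - E n y) + norm (x - y)"
      by (intro add_mono nonexpansive_clinearD(6) E order_refl)
    finally show ?thesis using N[OF that] y(2) by (simp add: dist_norm norm_minus_commute)
  qed
  then show "\<exists>M. \<forall>m\<ge>M. \<forall>n\<ge>M. norm (E m x - E n x) < e" by blast
qed

lemma bounded_linear_eq_on_closure:
  assumes f: "bounded_linear f" and g: "bounded_linear g"
    and eq: "\<And>y. y \<in> Y \<Longrightarrow> f y = g y" and x: "x \<in> closure Y"
  shows "f x = g x"
proof -
  have "closed {x. f x = g x}"
    by (intro closed_Collect_eq linear_continuous_on f g)
  then have "closure Y \<subseteq> {x. f x = g x}" using eq by (intro closure_minimal) auto
  with x show ?thesis by blast
qed

text \<open>Dissipativity is a norm inequality here, with no pairing involved. The range condition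
  is asked for every \<open>h\<close>, since the feedback operator satisfies it for each
  \<open>h\<close> by the same argument.\<close>

locale m_dissipative =
  fixes D :: "'a::complex_banach set" and A :: "'a \<Rightarrow> 'a"
  assumes linear: "linear_operator D A"
    and dissipative: "x \<in> D \<Longrightarrow> h > 0 \<Longrightarrow> norm x \<le> norm (x - h *\<^sub>R A x)"
    and range: "h > 0 \<Longrightarrow> \<exists>x\<in>D. x - h *\<^sub>R A x = y"
begin

lemmas D_simps = linear_operatorD[OF linear]

text \<open>\<open>J h\<close> stands for \<open>(1 - h A)\<^sup>-\<^sup>1\<close>; for \<open>h < 0\<close>, where this need not exist, it is a junk identity.\<close>

definition J :: "real \<Rightarrow> 'a \<Rightarrow> 'a"
  where "J h y = (if h > 0 then THE x. x \<in> D \<and> x - h *\<^sub>R A x = y else y)"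

lemma resolvent_unique:
  assumes "h > 0" "x \<in> D" "x' \<in> D" "x - h *\<^sub>R A x = x' - h *\<^sub>R A x'"
  shows "x = x'"
proof -
  have "norm (x - x') \<le> norm ((x - x') - h *\<^sub>R A (x - x'))" using assms by (intro dissipative D_simps)
  also have "(x - x') - h *\<^sub>R A (x - x') = 0" using assms by (simp add: D_simps algebra_simps)
  finally show ?thesis by simp
qed

lemma J_eqI: "h > 0 \<Longrightarrow> x \<in> D \<Longrightarrow> x - h *\<^sub>R A x = y \<Longrightarrow> J h y = x"
  unfolding J_def using resolvent_unique[of h] by (auto intro!: the_equality)

lemma J_in_D: "h > 0 \<Longrightarrow> J h y \<in> D"
  and J_solves: "h > 0 \<Longrightarrow> J h y - h *\<^sub>R A (J h y) = y"
  using range[of h y] J_eqI by auto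

lemma J_0: "J 0 = id"
  by (auto simp: J_def)

lemma J_in_D': "x \<in> D \<Longrightarrow> J h x \<in> D"
  using J_in_D[of h] by (cases "h > 0") (auto simp: J_def)

lemma nonexpansive_J: "nonexpansive_clinear (J h)"
proof (cases "h > 0")
  case h: True
  note J = J_in_D[OF h] J_solves[OF h]
  show ?thesis
  proof (rule nonexpansive_clinearI)
    fix x y
    have "J h x + J h y - h *\<^sub>R A (J h x + J h y) = (J h x - h *\<^sub>R A (J h x)) + (J h y - h *\<^sub>R A (J h y))"
      using J by (simp add: D_simps algebra_simps)
    then show "J h (x + y) = J h x + J h y" using J h by (intro J_eqI) (auto intro: D_simps)
  next
    fix c x
    have "c *\<^sub>C J h x - h *\<^sub>R A (c *\<^sub>C J h x) = c *\<^sub>C J h x - c *\<^sub>C h *\<^sub>R A (J h x)"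
      using J(1) by (simp add: D_simps scaleC_scaleR_commute)
    also have "\<dots> = c *\<^sub>C (J h x - h *\<^sub>R A (J h x))" by (simp add: scaleC_diff_right)
    finally show "J h (c *\<^sub>C x) = c *\<^sub>C J h x" using J h by (intro J_eqI) (auto intro: D_simps)
  next
    fix x show "norm (J h x) \<le> norm x" using dissipative[OF J(1) h] J(2) by metis
  qed
next
  case False
  then have "J h = id" by (auto simp: J_def)
  then show ?thesis by (simp add: nonexpansive_clinear_id)
qed

lemmas J_simps = nonexpansive_clinearD[OF nonexpansive_J]

text \<open>For \<open>z = J h x\<close> the resolvent equation makes \<open>A z\<close> a multiple
  of \<open>z - x\<close>, a difference of two points of \<open>D\<close>. Hence \<open>A z\<close>
  lies in \<open>D\<close> and \<open>A\<close> may be applied to the equation.\<close>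

lemma A_J: "x \<in> D \<Longrightarrow> A (J h x) = J h (A x)"
proof (cases "h > 0")
  case h: True
  assume x: "x \<in> D"
  define z where "z = J h x"
  have z: "z \<in> D" "z - h *\<^sub>R A z = x" using J_in_D[OF h] J_solves[OF h] by (auto simp: z_def)
  have "z - x = h *\<^sub>R A z" using z(2) by (simp add: algebra_simps)
  then have "A z = (1 / h) *\<^sub>R (z - x)" using h by simp
  then have Az: "A z \<in> D" using x z by (auto intro: D_simps)
  have "A z - h *\<^sub>R A (A z) = A (z - h *\<^sub>R A z)" using z(1) Az by (simp add: D_simps)
  then have "J h (A x) = A z" using Az z(2) h by (intro J_eqI) auto
  then show ?thesis by (simp add: z_def)
qed (simp add: J_def)

lemma J_diff: "x \<in> D \<Longrightarrow> h \<ge> 0 \<Longrightarrow> J h x - x = h *\<^sub>R J h (A x)"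
  using J_solves[of h x] A_J[of x h] by (cases "h = 0") (auto simp: J_0 algebra_simps)

lemma norm_J_diff: "x \<in> D \<Longrightarrow> h \<ge> 0 \<Longrightarrow> norm (J h x - x) \<le> h * norm (A x)"
  by (simp add: J_diff mult_left_mono J_simps)

text \<open>Applying \<open>J a\<close> to the equation solved by \<open>J b y\<close> and moving it
  past \<open>A\<close> gives the equation that determines \<open>J b (J a y)\<close>.\<close>

lemma J_commute: "J a \<circ> J b = J b \<circ> J a"
proof (cases "a > 0 \<and> b > 0")
  case True
  show ?thesis
  proof
    fix y
    define v where "v = J a (J b y)"
    have Jb: "J b y \<in> D" "J b y - b *\<^sub>R A (J b y) = y" using True J_in_D J_solves by auto
    have v: "v \<in> D" using True J_in_D by (simp add: v_def)
    have "v - b *\<^sub>R A v = J a (J b y - b *\<^sub>R A (J b y))"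
      unfolding v_def by (simp add: A_J[OF Jb(1)] J_simps)
    then have "J b (J a y) = v" using True v Jb(2) by (intro J_eqI) auto
    then show "(J a \<circ> J b) y = (J b \<circ> J a) y" by (simp add: v_def)
  qed
qed (auto simp: J_def)

lemma J_J: "J a (J b x) = J b (J a x)"
  using fun_cong[OF J_commute, of a b x] by simp

lemma J_commute2: "J c \<circ> (J a \<circ> J b) = (J a \<circ> J b) \<circ> J c"
  by (simp add: fun_eq_iff J_J[of c])

text \<open>The domain of the square of \<open>A\<close>, where splitting an Euler step costs only a
  second-order error.\<close>

definition D2 :: "'a set"
  where "D2 = {x \<in> D. A x \<in> D}"

lemma J_in_D2: "x \<in> D \<Longrightarrow> h > 0 \<Longrightarrow> J h x \<in> D2"
  by (simp add: D2_def J_in_D A_J)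

lemma J_in_D2': "x \<in> D2 \<Longrightarrow> J h x \<in> D2"
  by (simp add: D2_def J_in_D' A_J)

text \<open>Comes from \<open>(1 - a A) (1 - b A) = 1 - (a + b) A + a b A\<^sup>2\<close>.\<close>

lemma norm_J_add_diff:
  assumes x: "x \<in> D2" and ab: "a \<ge> 0" "b \<ge> 0"
  shows "norm (J (a + b) x - J a (J b x)) \<le> a * b * norm (A (A x))"
proof (cases "a = 0 \<or> b = 0")
  case False
  with ab have pos: "a > 0" "b > 0" "a + b > 0" by auto
  define y where "y = J a (J b x)"
  have D: "y \<in> D" "A y \<in> D" "J b x \<in> D" using J_in_D2'[OF J_in_D2'[OF x]] J_in_D2'[OF x]
    by (auto simp: D2_def y_def)
  \<comment> \<open>Moving both resolvents outside bounds the error by \<open>A (A x)\<close> at the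
    starting point, independently of \<open>a\<close> and \<open>b\<close>.\<close>
  have AAy: "A (A y) = J a (J b (A (A x)))"
    using x D by (simp add: y_def A_J D2_def J_in_D')
  have "y - (a + b) *\<^sub>R A y + (a * b) *\<^sub>R A (A y) = (y - a *\<^sub>R A y) - b *\<^sub>R A (y - a *\<^sub>R A y)"
    using D by (simp add: D_simps algebra_simps)
  also have "\<dots> = x" using J_solves[OF pos(1), of "J b x"] J_solves[OF pos(2), of x] by (simp add: y_def)
  finally have "y - (a + b) *\<^sub>R A y = x - (a * b) *\<^sub>R A (A y)" by (simp add: algebra_simps)
  then have "y = J (a + b) x - (a * b) *\<^sub>R J (a + b) (A (A y))"
    using J_eqI[OF pos(3) D(1)] by (simp add: J_simps)
  then have "J (a + b) x - y = (a * b) *\<^sub>R J (a + b) (A (A y))" by (simp add: algebra_simps)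
  then have "norm (J (a + b) x - y) = a * b * norm (J (a + b) (A (A y)))" using pos by simp
  also have "\<dots> \<le> a * b * norm (A (A x))"
    unfolding AAy using pos by (intro mult_left_mono order_trans[OF J_simps(6)] J_simps) auto
  finally show ?thesis by (simp add: y_def)
qed (auto simp: J_0)

end

section \<open>The semigroup as the limit of dyadic Euler steps\<close>

locale dense_m_dissipative = m_dissipative +
  assumes dense: "closure D = UNIV"
begin

lemma J_tendsto: "((\<lambda>h. J h x) \<longlongrightarrow> x) (at_right 0)"
proof (rule tendstoI)
  fix e :: real assume "e > 0"
  then have e3: "e / 3 > 0" by simp
  then obtain y where y: "y \<in> D" "dist y x < e / 3" using dense closure_approachable by blast
  have "((\<lambda>h. h * norm (A y)) \<longlongrightarrow> 0 * norm (A y)) (at_right 0)" by (intro tendsto_intros)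
  then have "\<forall>\<^sub>F h in at_right 0. h * norm (A y) < e / 3" using e3 by (intro order_tendstoD(2)) auto
  then show "\<forall>\<^sub>F h in at_right 0. dist (J h x) x < e"
    using eventually_at_right_less
  proof eventually_elim
    case (elim h)
    have "J h x - x = J h (x - y) + (J h y - y) - (x - y)" by (simp add: J_simps)
    also have "norm \<dots> \<le> norm (J h (x - y)) + norm (J h y - y) + norm (x - y)"
      by (rule norm_add_diff_le)
    also have "\<dots> \<le> norm (x - y) + h * norm (A y) + norm (x - y)"
      using elim y by (intro add_mono J_simps norm_J_diff) auto
    finally show ?case using elim y(2) by (simp add: dist_norm norm_minus_commute)
  qed
qed

text \<open>Two resolvents lead into \<open>D2\<close>: the first maps into \<open>D\<close>, and
  the second maps \<open>D\<close> into \<open>D2\<close> because it commutes with \<open>A\<close>.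
  As \<open>h\<close> tends to 0 their composition tends to the identity.\<close>

lemma dense_D2: "closure D2 = UNIV"
proof -
  have "x \<in> closure D2" for x
  proof -
    have "((\<lambda>h. norm (J h x - x) + norm (J h x - x)) \<longlongrightarrow> norm (x - x) + norm (x - x)) (at_right 0)"
      by (intro tendsto_intros J_tendsto)
    then have lim0: "((\<lambda>h. norm (J h x - x) + norm (J h x - x)) \<longlongrightarrow> 0) (at_right 0)" by simp
    have le: "norm (J h (J h x) - x) \<le> norm (J h x - x) + norm (J h x - x)" for h
    proof -
      have "J h (J h x) - x = J h (J h x - x) + (J h x - x)" by (simp add: J_simps)
      also have "norm \<dots> \<le> norm (J h (J h x - x)) + norm (J h x - x)" by (rule norm_triangle_ineq)
      finally show ?thesis using J_simps(6)[of h "J h x - x"] by linarith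
    qed
    have "((\<lambda>h. J h (J h x) - x) \<longlongrightarrow> 0) (at_right 0)"
      by (rule Lim_null_comparison[OF _ lim0]) (use le in simp)
    then have lim: "((\<lambda>h. J h (J h x)) \<longlongrightarrow> x) (at_right 0)" by (rule LIM_zero_cancel)
    have "\<forall>\<^sub>F h in at_right 0. J h (J h x) \<in> closure D2"
      using eventually_at_right_less
      by eventually_elim (intro subsetD[OF closure_subset] J_in_D2 J_in_D)
    then show ?thesis by (rule Lim_in_closed_set[OF closed_closure _ _ lim]) simp
  qed
  then show ?thesis by auto
qed

text \<open>Passing from \<open>n\<close> to \<open>Suc n\<close> halves every step, so consecutive
  approximations differ by replacing \<open>J (2 * h)\<close> with two copies of
  \<open>J h\<close>.\<close>

definition E :: "nat \<Rightarrow> real \<Rightarrow> 'a \<Rightarrow> 'a"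
  where "E n t = J (t / 2 ^ n) ^^ (2 ^ n)"

lemma nonexpansive_E: "nonexpansive_clinear (E n t)"
  unfolding E_def by (intro nonexpansive_clinear_funpow nonexpansive_J)

lemmas E_simps = nonexpansive_clinearD[OF nonexpansive_E]

text \<open>Each of the \<open>2 ^ n\<close> coarse steps contributes
  \<open>h * h * norm (A (A x))\<close> with \<open>h = t / 2 ^ Suc n\<close>. The total is
  geometric in \<open>n\<close>, hence summable.\<close>

lemma norm_E_step:
  assumes x: "x \<in> D2" and t: "t \<ge> 0"
  shows "norm (E (Suc n) t x - E n t x) \<le> t\<^sup>2 / 4 * norm (A (A x)) / 2 ^ n"
proof -
  define h where "h = t / 2 ^ Suc n"
  have h: "h \<ge> 0" "t / 2 ^ n = h + h" using t by (auto simp: h_def field_simps)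
  have "E (Suc n) t = (J h \<circ> J h) ^^ (2 ^ n)"
    unfolding E_def h_def[symmetric] by (simp add: funpow_comp[OF refl] mult_2 funpow_add)
  then have "norm (E (Suc n) t x - E n t x) = norm ((J (h + h) ^^ (2 ^ n)) x - ((J h \<circ> J h) ^^ (2 ^ n)) x)"
    by (simp add: E_def[of n] h(2) norm_minus_commute)
  also have "\<dots> \<le> real (2 ^ n) * norm (J (h + h) x - (J h \<circ> J h) x)"
    by (intro norm_diff_funpow_le nonexpansive_clinear_comp nonexpansive_J J_commute2)
  also have "\<dots> \<le> real (2 ^ n) * (h * h * norm (A (A x)))"
    using norm_J_add_diff[OF x h(1) h(1)] by (intro mult_left_mono) auto
  also have "\<dots> = t\<^sup>2 / 4 * norm (A (A x)) / 2 ^ n" by (simp add: h_def field_simps power2_eq_square)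
  finally show ?thesis .
qed

text \<open>Summing the geometric bounds starting from \<open>E 0 t = J t\<close>; the induction
  keeps the exact partial sum, with factor \<open>1 - 1 / 2 ^ n\<close>. The bound is quadratic in
  \<open>t\<close> uniformly in \<open>n\<close>, so in the limit \<open>T t x\<close> and
  \<open>J t x\<close> have the same derivative at 0.\<close>

lemma norm_E_diff_J:
  assumes x: "x \<in> D2" and t: "t \<ge> 0"
  shows "norm (E n t x - J t x) \<le> t\<^sup>2 / 2 * norm (A (A x))"
proof -
  have "norm (E n t x - J t x) \<le> t\<^sup>2 / 2 * norm (A (A x)) * (1 - 1 / 2 ^ n)"
  proof (induction n)
    case (Suc n)
    have "norm (E (Suc n) t x - J t x) \<le> norm (E (Suc n) t x - E n t x) + norm (E n t x - J t x)"
      using norm_triangle_ineq[of "E (Suc n) t x - E n t x" "E n t x - J t x"] by simp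
    also have "\<dots> \<le> t\<^sup>2 / 4 * norm (A (A x)) / 2 ^ n + t\<^sup>2 / 2 * norm (A (A x)) * (1 - 1 / 2 ^ n)"
      by (intro add_mono Suc norm_E_step x t)
    also have "\<dots> = t\<^sup>2 / 2 * norm (A (A x)) * (1 - 1 / 2 ^ Suc n)" by (simp add: field_simps)
    finally show ?case .
  qed (simp add: E_def)
  also have "\<dots> \<le> t\<^sup>2 / 2 * norm (A (A x)) * 1" by (intro mult_left_mono) auto
  finally show ?thesis by simp
qed

lemma convergent_E:
  assumes t: "t \<ge> 0"
  shows "convergent (\<lambda>n. E n t x)"
proof (rule convergent_if_convergent_on_dense[OF nonexpansive_E])
  show "x \<in> closure D2" by (simp add: dense_D2)
  fix y assume y: "y \<in> D2"
  have "summable (\<lambda>n. E (Suc n) t y - E n t y)"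
  proof (rule summable_comparison_test')
    show "summable (\<lambda>n. t\<^sup>2 / 4 * norm (A (A y)) * (1 / 2) ^ n)"
      by (intro summable_mult summable_geometric) simp
    show "norm (E (Suc n) t y - E n t y) \<le> t\<^sup>2 / 4 * norm (A (A y)) * (1 / 2) ^ n" for n
      using norm_E_step[OF y t, of n] by (simp add: power_divide)
  qed
  then have "convergent (\<lambda>n. \<Sum>k<n. E (Suc k) t y - E k t y)" by (simp add: summable_iff_convergent)
  then have "convergent (\<lambda>n. E n t y - E 0 t y)" by (simp add: sum_lessThan_telescope[of "\<lambda>k. E k t y"])
  then show "convergent (\<lambda>n. E n t y)"
    using convergent_add[OF _ convergent_const[of "E 0 t y"]] by force
qed

definition T :: "real \<Rightarrow> 'a \<Rightarrow> 'a"
  where "T t x = lim (\<lambda>n. E n t x)"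

lemma E_tendsto: "t \<ge> 0 \<Longrightarrow> (\<lambda>n. E n t x) \<longlonglongrightarrow> T t x"
  unfolding T_def using convergent_E by (simp add: convergent_LIMSEQ_iff)

lemma nonexpansive_T: "t \<ge> 0 \<Longrightarrow> nonexpansive_clinear (T t)"
  using nonexpansive_clinear_lim[OF nonexpansive_E E_tendsto] .

lemma T_0: "T 0 = id"
proof
  fix x show "T 0 x = id x"
    using E_tendsto[of 0 x] by (simp add: E_def J_0 LIMSEQ_const_iff)
qed

text \<open>The approximations satisfy the semigroup law only up to an error: \<open>2 ^ n\<close>
  steps, each costing a multiple of \<open>a * b = s * t / 4 ^ n\<close>. The law is first obtained
  on \<open>D2\<close> and extended by density.\<close>

lemma T_add:
  assumes s: "s \<ge> 0" and t: "t \<ge> 0"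
  shows "T (s + t) = T s \<circ> T t"
proof
  fix x
  have "T (s + t) y = (T s \<circ> T t) y" if y: "y \<in> D2" for y
  proof -
    have "norm (E n (s + t) y - E n s (E n t y)) \<le> s * t * norm (A (A y)) * (1 / 2) ^ n" for n
    proof -
      define a b where "a = s / 2 ^ n" and "b = t / 2 ^ n"
      have ab: "a \<ge> 0" "b \<ge> 0" "(s + t) / 2 ^ n = a + b"
        using s t by (auto simp: a_def b_def add_divide_distrib)
      have "E n s \<circ> E n t = (J a \<circ> J b) ^^ (2 ^ n)"
        unfolding E_def a_def[symmetric] b_def[symmetric] by (simp add: funpow_comp[OF J_commute])
      then have "norm (E n (s + t) y - E n s (E n t y)) = norm ((J (a + b) ^^ (2 ^ n)) y - ((J a \<circ> J b) ^^ (2 ^ n)) y)"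
        by (simp add: E_def[of n "s + t"] ab(3) fun_eq_iff)
      also have "\<dots> \<le> real (2 ^ n) * norm (J (a + b) y - (J a \<circ> J b) y)"
        by (intro norm_diff_funpow_le nonexpansive_clinear_comp nonexpansive_J J_commute2)
      also have "\<dots> \<le> real (2 ^ n) * (a * b * norm (A (A y)))"
        using norm_J_add_diff[OF y ab(1,2)] by (intro mult_left_mono) auto
      also have "\<dots> = s * t * norm (A (A y)) * (1 / 2) ^ n" by (simp add: a_def b_def field_simps)
      finally show ?thesis .
    qed
    note le = this
    have lim0: "(\<lambda>n. s * t * norm (A (A y)) * (1 / 2) ^ n) \<longlonglongrightarrow> 0"
      by (intro tendsto_mult_right_zero LIMSEQ_realpow_zero) auto
    have 1: "(\<lambda>n. E n (s + t) y - E n s (E n t y)) \<longlonglongrightarrow> 0"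
      by (rule Lim_null_comparison[OF _ lim0]) (use le in simp)
    \<comment> \<open>Both the operator and its argument vary with \<open>n\<close>;
      nonexpansiveness of \<open>E n s\<close> reduces the double limit to two simple ones.\<close>
    have "(\<lambda>n. E n s (E n t y - T t y)) \<longlonglongrightarrow> 0"
    proof (rule Lim_null_comparison)
      show "\<forall>\<^sub>F n in sequentially. norm (E n s (E n t y - T t y)) \<le> norm (E n t y - T t y)"
        using E_simps(6) by simp
      show "(\<lambda>n. norm (E n t y - T t y)) \<longlonglongrightarrow> 0"
        by (intro tendsto_norm_zero LIM_zero E_tendsto t)
    qed
    from tendsto_add[OF tendsto_add[OF 1 this] E_tendsto[OF s, of "T t y"]]
    have "(\<lambda>n. E n (s + t) y) \<longlonglongrightarrow> T s (T t y)" by (simp add: E_simps)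
    then show ?thesis using E_tendsto[of "s + t" y] s t LIMSEQ_unique by force
  qed
  note eq = this
  have "bounded_linear (T (s + t))" "bounded_linear (T s \<circ> T t)"
    using s t by (simp_all add: nonexpansive_clinearD(1) nonexpansive_T nonexpansive_clinear_comp)
  then show "T (s + t) x = (T s \<circ> T t) x"
  proof (rule bounded_linear_eq_on_closure)
    show "x \<in> closure D2" by (simp add: dense_D2)
  qed (rule eq)
qed

text \<open>The telescoping estimate with powers of \<open>id\<close> as the second family:
  \<open>2 ^ n\<close> steps, each moving \<open>x\<close> by at most
  \<open>t / 2 ^ n * norm (A x)\<close>.\<close>

lemma norm_T_diff:
  assumes x: "x \<in> D" and t: "t \<ge> 0"
  shows "norm (T t x - x) \<le> t * norm (A x)"
proof (rule Lim_norm_ubound)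
  show "(\<lambda>n. E n t x - x) \<longlonglongrightarrow> T t x - x" by (intro tendsto_intros E_tendsto t)
  have "norm (E n t x - x) \<le> t * norm (A x)" for n
  proof -
    have id_pow: "(id ^^ k) x = x" for k by (induction k) auto
    have "norm (E n t x - x) = norm ((J (t / 2 ^ n) ^^ (2 ^ n)) x - (id ^^ (2 ^ n)) x)"
      by (simp add: E_def id_pow)
    also have "\<dots> \<le> real (2 ^ n) * norm (J (t / 2 ^ n) x - id x)"
      by (intro norm_diff_funpow_le nonexpansive_clinear_id nonexpansive_J) simp
    also have "\<dots> \<le> real (2 ^ n) * (t / 2 ^ n * norm (A x))"
      using t norm_J_diff[OF x, of "t / 2 ^ n"] by (intro mult_left_mono) auto
    finally show ?thesis by simp
  qed
  then show "\<forall>\<^sub>F n in sequentially. norm (E n t x - x) \<le> t * norm (A x)" by simp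
qed simp

lemma norm_T_diff_J:
  assumes x: "x \<in> D2" and t: "t \<ge> 0"
  shows "norm (T t x - J t x) \<le> t\<^sup>2 / 2 * norm (A (A x))"
proof (rule Lim_norm_ubound)
  show "(\<lambda>n. E n t x - J t x) \<longlonglongrightarrow> T t x - J t x" by (intro tendsto_intros E_tendsto t)
  show "\<forall>\<^sub>F n in sequentially. norm (E n t x - J t x) \<le> t\<^sup>2 / 2 * norm (A (A x))"
    using norm_E_diff_J[OF x t] by (intro always_eventually) simp
qed simp

lemma contraction_T: "contraction_C0_semigroup T"
  unfolding contraction_C0_semigroup_def
proof (intro conjI allI impI T_0 T_add)
  fix t :: real assume "t \<ge> 0"
  note nonexpansive_T[OF this]
  then show "bounded_clinear (T t)" "onorm (T t) \<le> 1"
    by (auto simp: nonexpansive_clinear_def intro!: onorm_bound)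
next
  fix x
  have *: "dist (T t x) (T s x) \<le> 2 * norm (x - y) + (t - s) * norm (A y)"
    if "0 \<le> s" "s \<le> t" "y \<in> D" for s t y
  proof -
    note S = nonexpansive_clinearD[OF nonexpansive_T[OF \<open>0 \<le> s\<close>]]
    have d: "t - s \<ge> 0" using that by simp
    note TD = nonexpansive_clinearD[OF nonexpansive_T[OF d]]
    have "T t x = T s (T (t - s) x)" using T_add[of s "t - s"] that by simp
    then have "dist (T t x) (T s x) = norm (T s (T (t - s) x - x))" by (simp add: dist_norm S)
    also have "\<dots> \<le> norm (T (t - s) x - x)" by (rule S)
    also have "T (t - s) x - x = T (t - s) (x - y) + (T (t - s) y - y) - (x - y)" by (simp add: TD)
    also have "norm \<dots> \<le> norm (T (t - s) (x - y)) + norm (T (t - s) y - y) + norm (x - y)"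
      by (rule norm_add_diff_le)
    also have "\<dots> \<le> norm (x - y) + (t - s) * norm (A y) + norm (x - y)"
      by (intro add_mono TD norm_T_diff that d order_refl)
    finally show ?thesis by simp
  qed
  show "continuous_on {0..} (\<lambda>t. T t x)"
    unfolding continuous_on_iff
  proof (intro ballI allI impI)
    fix t e :: real assume t: "t \<in> {0..}" and e: "e > 0"
    then have "e / 4 > 0" by simp
    then obtain y where y: "y \<in> D" "dist y x < e / 4" using dense closure_approachable by blast
    \<comment> \<open>Half of \<open>e\<close> pays for replacing \<open>x\<close> by
      \<open>y\<close>, half for the Lipschitz bound at \<open>y\<close>; adding 1 keeps the
      denominator positive when \<open>A y = 0\<close>.\<close>
    define d where "d = e / (2 * (norm (A y) + 1))"
    have d: "d > 0" using e unfolding d_def by (intro divide_pos_pos) (auto intro: add_nonneg_pos)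
    have "dist (T s x) (T t x) < e" if s: "s \<in> {0..}" "dist s t < d" for s
    proof -
      have "dist (T s x) (T t x) \<le> 2 * norm (x - y) + \<bar>s - t\<bar> * norm (A y)"
        using *[of s t y] *[of t s y] s t y by (cases "s \<le> t") (auto simp: dist_commute)
      also have "\<bar>s - t\<bar> * norm (A y) \<le> d * (norm (A y) + 1)"
        using s d by (intro mult_mono) (auto simp: dist_norm)
      also have "d * (norm (A y) + 1) = e / 2"
        using norm_ge_zero[of "A y"] by (simp add: d_def field_simps add_nonneg_eq_0_iff)
      finally show ?thesis using y by (simp add: dist_norm norm_minus_commute)
    qed
    then show "\<exists>d>0. \<forall>s\<in>{0..}. dist s t < d \<longrightarrow> dist (T s x) (T t x) < e" using d by blast
  qed
qed

text \<open>\<open>T h x\<close> is replaced by \<open>J h x\<close> at a cost of order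
  \<open>h\<close> squared, and the difference quotient of \<open>J\<close> is exactly
  \<open>J h (A x)\<close>.\<close>

lemma T_derivative_on_D2:
  assumes x: "x \<in> D2"
  shows "((\<lambda>h. (T h x - x) /\<^sub>R h) \<longlongrightarrow> A x) (at_right 0)"
proof -
  have "((\<lambda>h. (T h x - J h x) /\<^sub>R h) \<longlongrightarrow> 0) (at_right 0)"
  proof (rule Lim_null_comparison)
    have "((\<lambda>h. h / 2 * norm (A (A x))) \<longlongrightarrow> 0 / 2 * norm (A (A x))) (at_right 0)" by (intro tendsto_intros) simp
    then show "((\<lambda>h. h / 2 * norm (A (A x))) \<longlongrightarrow> 0) (at_right 0)" by simp
    show "\<forall>\<^sub>F h in at_right 0. norm ((T h x - J h x) /\<^sub>R h) \<le> h / 2 * norm (A (A x))"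
      using eventually_at_right_less
    proof eventually_elim
      case (elim h)
      then show ?case
        using norm_T_diff_J[OF x, of h] by (intro norm_divideR_le) (auto simp: power2_eq_square)
    qed
  qed
  from tendsto_add[OF this J_tendsto[of "A x"]]
  have lim: "((\<lambda>h. (T h x - J h x) /\<^sub>R h + J h (A x)) \<longlongrightarrow> A x) (at_right 0)" by simp
  have "\<forall>\<^sub>F h in at_right 0. (T h x - J h x) /\<^sub>R h + J h (A x) = (T h x - x) /\<^sub>R h"
    using eventually_at_right_less
  proof eventually_elim
    case (elim h)
    have "J h x - x = h *\<^sub>R J h (A x)" using x elim by (intro J_diff) (auto simp: D2_def)
    then have "J h (A x) = (J h x - x) /\<^sub>R h" using elim by simp
    then show ?case by (simp flip: scaleR_add_right)
  qed
  then show ?thesis using lim by (rule Lim_transform_eventually[rotated])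
qed

text \<open>\<open>D2\<close> is a core: \<open>y = J k x\<close> approximates \<open>x\<close>
  while \<open>A y = J k (A x)\<close> approximates \<open>A x\<close>. The difference quotient at
  \<open>x - y\<close> is at most \<open>norm (A (x - y))\<close> for all \<open>h\<close>, by
  \<open>norm_T_diff\<close>.\<close>

lemma T_derivative:
  assumes x: "x \<in> D"
  shows "((\<lambda>h. (T h x - x) /\<^sub>R h) \<longlongrightarrow> A x) (at_right 0)"
proof (rule tendstoI)
  fix e :: real assume e: "e > 0"
  have "\<forall>\<^sub>F k in at_right 0. dist (J k (A x)) (A x) < e / 3 \<and> k > 0"
    using e by (intro eventually_conj tendstoD[OF J_tendsto] eventually_at_right_less) simp
  then obtain k where k: "k > 0" "dist (J k (A x)) (A x) < e / 3"
    using eventually_happens'[of "at_right (0::real)"] by force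
  define y where "y = J k x"
  have y: "y \<in> D2" "y \<in> D" "norm (A x - A y) < e / 3"
    using k x by (auto simp: y_def J_in_D2 J_in_D A_J dist_norm norm_minus_commute)
  have "\<forall>\<^sub>F h in at_right 0. dist ((T h y - y) /\<^sub>R h) (A y) < e / 3"
    using tendstoD[OF T_derivative_on_D2[OF y(1)], of "e / 3"] e by simp
  then show "\<forall>\<^sub>F h in at_right 0. dist ((T h x - x) /\<^sub>R h) (A x) < e"
    using eventually_at_right_less
  proof eventually_elim
    case (elim h)
    note TD = nonexpansive_clinearD[OF nonexpansive_T[of h]]
    have "norm (T h (x - y) - (x - y)) \<le> h * norm (A (x - y))"
      using x y elim by (intro norm_T_diff) (auto intro: D_simps)
    then have 1: "norm ((T h (x - y) - (x - y)) /\<^sub>R h) \<le> norm (A x - A y)"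
      using elim x y by (intro norm_divideR_le) (simp_all add: D_simps)
    have "T h x - x = (T h (x - y) - (x - y)) + (T h y - y)" by (simp add: TD(3)[OF less_imp_le] elim)
    then have "(T h x - x) /\<^sub>R h = (T h (x - y) - (x - y)) /\<^sub>R h + (T h y - y) /\<^sub>R h"
      by (simp only: scaleR_add_right)
    then have "(T h x - x) /\<^sub>R h - A x =
        (T h (x - y) - (x - y)) /\<^sub>R h + ((T h y - y) /\<^sub>R h - A y) - (A x - A y)"
      by (simp only: diff_conv_add_uminus minus_add_distrib minus_minus ac_simps) simp
    also have "norm \<dots> \<le> norm ((T h (x - y) - (x - y)) /\<^sub>R h) + norm ((T h y - y) /\<^sub>R h - A y) + norm (A x - A y)"
      by (rule norm_add_diff_le)
    finally show ?case using 1 elim y by (simp add: dist_norm)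
  qed
qed

end

section \<open>Contraction semigroups and maximality of the generator\<close>

lemma infinitesimal_generatorD:
  assumes "infinitesimal_generator T D A" "x \<in> D"
  shows "((\<lambda>h. (T h x - x) /\<^sub>R h) \<longlongrightarrow> A x) (at_right 0)"
  using assms by (simp add: infinitesimal_generator_def)

lemma contraction_C0_semigroupD:
  assumes "contraction_C0_semigroup T" and t: "t \<ge> 0"
  shows "bounded_linear (T t)" "norm (T t x) \<le> norm x"
    "s \<ge> 0 \<Longrightarrow> T (s + t) x = T s (T t x)" "T 0 x = x" "continuous_on {0..} (\<lambda>t. T t x)"
proof -
  note defs = assms(1)[unfolded contraction_C0_semigroup_def]
  show bl: "bounded_linear (T t)" using defs t by (simp add: bounded_clinear_def)
  have "norm (T t x) \<le> onorm (T t) * norm x" by (rule onorm[OF bl])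
  also have "\<dots> \<le> 1 * norm x" using defs t by (intro mult_right_mono) auto
  finally show "norm (T t x) \<le> norm x" by simp
qed (use assms in \<open>auto simp: contraction_C0_semigroup_def\<close>)

text \<open>Dissipativity of a generator without duality: \<open>z + h *\<^sub>R v\<close> differs
  from \<open>T h z\<close> by an error of order below \<open>h\<close>, and \<open>T h z\<close> is
  no longer than \<open>z\<close>.\<close>

lemma semigroup_norm_forward_le:
  assumes T: "contraction_C0_semigroup T"
    and lim: "((\<lambda>h. (T h z - z) /\<^sub>R h) \<longlongrightarrow> v) (at_right 0)" and e: "e > 0"
  shows "\<forall>\<^sub>F h in at_right 0. norm (z + h *\<^sub>R v) \<le> norm z + e * h"
  using tendstoD[OF lim e] eventually_at_right_less
proof eventually_elim
  case (elim h)
  have "z + h *\<^sub>R v = T h z - h *\<^sub>R ((T h z - z) /\<^sub>R h - v)" using elim by (simp add: scaleR_diff_right)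
  also have "norm \<dots> \<le> norm (T h z) + norm (h *\<^sub>R ((T h z - z) /\<^sub>R h - v))" by (rule norm_triangle_ineq4)
  also have "norm (T h z) \<le> norm z" using elim by (intro contraction_C0_semigroupD[OF T]) simp
  also have "norm (h *\<^sub>R ((T h z - z) /\<^sub>R h - v)) \<le> e * h" using elim by (simp add: dist_norm mult.commute)
  finally show ?case by simp
qed

text \<open>The number 1 is no eigenvalue of a generator, since otherwise the norm would grow by
  \<open>h * norm w\<close>. Phrased by the limit because it is applied before the generator of
  \<open>T\<close> is identified.\<close>

lemma semigroup_derivative_fixed_eq_0:
  assumes T: "contraction_C0_semigroup T"
    and lim: "((\<lambda>h. (T h w - w) /\<^sub>R h) \<longlongrightarrow> w) (at_right 0)"
  shows "w = 0"
proof (rule ccontr)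
  assume "w \<noteq> 0"
  then have "norm w / 2 > 0" by simp
  then have "\<forall>\<^sub>F h in at_right 0. norm (w + h *\<^sub>R w) \<le> norm w + norm w / 2 * h \<and> h > 0"
    by (intro eventually_conj semigroup_norm_forward_le[OF T lim] eventually_at_right_less)
  then obtain h where h: "norm (w + h *\<^sub>R w) \<le> norm w + norm w / 2 * h" "h > 0"
    using eventually_happens'[of "at_right (0::real)"] by force
  have "w + h *\<^sub>R w = (1 + h) *\<^sub>R w" by (simp add: scaleR_left_distrib)
  then have "norm (w + h *\<^sub>R w) = (1 + h) * norm w" using h by simp
  with h have "h * norm w \<le> 0" by (simp add: algebra_simps)
  with h \<open>w \<noteq> 0\<close> show False by (simp add: mult_le_0_iff)
qed

theorem (in dense_m_dissipative) generates_semigroup: "generates_contraction_C0_semigroup D A"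
proof -
  have "x \<in> D" if lim: "((\<lambda>h. (T h x - x) /\<^sub>R h) \<longlongrightarrow> y) (at_right 0)" for x y
  proof -
    \<comment> \<open>The generator of \<open>T\<close> extends \<open>A\<close>. As
      \<open>1 - A\<close> is already onto and the generator minus 1 is injective, \<open>x\<close>
      must coincide with the point \<open>z\<close> of \<open>D\<close>.\<close>
    obtain z where z: "z \<in> D" "z - A z = x - y" using range[of 1 "x - y"] by auto
    have "\<forall>\<^sub>F h in at_right 0. (T h x - x) /\<^sub>R h - (T h z - z) /\<^sub>R h = (T h (x - z) - (x - z)) /\<^sub>R h"
      using eventually_at_right_less
    proof eventually_elim
      case (elim h)
      have "T h (x - z) = T h x - T h z"
        using elim by (intro nonexpansive_clinearD(3)[OF nonexpansive_T]) simp
      then have "T h (x - z) - (x - z) = (T h x - x) - (T h z - z)" by simp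
      then show ?case by (simp only: scaleR_diff_right)
    qed
    with tendsto_diff[OF lim T_derivative[OF z(1)]]
    have "((\<lambda>h. (T h (x - z) - (x - z)) /\<^sub>R h) \<longlongrightarrow> y - A z) (at_right 0)"
      by (rule Lim_transform_eventually)
    also have "y - A z = x - z" using z(2) by (simp add: algebra_simps)
    finally have "x - z = 0" by (rule semigroup_derivative_fixed_eq_0[OF contraction_T])
    with z show ?thesis by simp
  qed
  then have "infinitesimal_generator T D A"
    unfolding infinitesimal_generator_def using T_derivative by blast
  then show ?thesis unfolding generates_contraction_C0_semigroup_def using contraction_T by blast
qed

text \<open>A generalized limit of \<open>J (1 / n) a\<close> is, by reflexivity, the evaluation at a point \<open>y\<close>. If \<open>D\<close>
  were not dense, a functional vanishing on \<open>D\<close> but not at \<open>a\<close> would separate \<open>y\<close> from \<open>a\<close>, while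
  \<open>J 1 y = J 1 a\<close> because \<open>J (1 / n)\<close> converges to the identity on \<open>D\<close>.\<close>

lemma (in m_dissipative) reflexive_dense:
  assumes refl: "reflexive_space TYPE('a)"
  shows "closure D = UNIV"
proof (rule ccontr)
  assume "closure D \<noteq> UNIV"
  then obtain a where "a \<notin> closure D" by auto
  then obtain u :: "'a \<Rightarrow>\<^sub>L real" where u: "\<And>x. x \<in> D \<Longrightarrow> u x = 0" "u a \<noteq> 0"
    using functional_separates_subspace[OF D_simps(6)] by blast
  define h where "h = (\<lambda>n. 1 / real (Suc n))"
  have h: "h n > 0" for n by (simp add: h_def)
  obtain \<psi> :: "('a \<Rightarrow>\<^sub>L real) \<Rightarrow> real" where \<psi>: "bounded_linear \<psi>"
      "\<And>g l. (\<lambda>n. blinfun_apply g (J (h n) a)) \<longlonglongrightarrow> l \<Longrightarrow> \<psi> g = l"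
    using generalized_limit[of "\<lambda>n. J (h n) a" "norm a"] J_simps(6) by blast
  obtain y where y: "\<And>g. \<psi> g = blinfun_apply g y" using reflexive_space_real_bidual[OF refl \<psi>(1)] by blast
  have "blinfun_apply g (J 1 y) = g (J 1 a)" for g :: "'a \<Rightarrow>\<^sub>L real"
  proof -
    have "(\<lambda>n. J (h n) (J 1 a) - J 1 a) \<longlonglongrightarrow> 0"
    proof (rule Lim_null_comparison)
      have "(\<lambda>n. h n * norm (A (J 1 a))) \<longlonglongrightarrow> 0 * norm (A (J 1 a))"
        unfolding h_def by (intro tendsto_intros LIMSEQ_Suc[OF lim_1_over_n])
      then show "(\<lambda>n. h n * norm (A (J 1 a))) \<longlonglongrightarrow> 0" by simp
      show "\<forall>\<^sub>F n in sequentially. norm (J (h n) (J 1 a) - J 1 a) \<le> h n * norm (A (J 1 a))"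
        using h by (intro always_eventually allI norm_J_diff J_in_D) (auto simp: less_imp_le)
    qed
    then have "(\<lambda>n. J (h n) (J 1 a)) \<longlonglongrightarrow> J 1 a" by (rule LIM_zero_cancel)
    then have "(\<lambda>n. g (J 1 (J (h n) a))) \<longlonglongrightarrow> g (J 1 a)"
      unfolding J_J[of 1] by (intro tendsto_intros)
    \<comment> \<open>\<psi> at this functional has two values: \<open>g (J 1 y)\<close> by the
      choice of \<open>y\<close>, and \<open>g (J 1 a)\<close> by the limit, the resolvents having
      been exchanged.\<close>
    moreover define f where "f = Blinfun (\<lambda>x. g (J 1 x))"
    have f: "f x = g (J 1 x)" for x
      unfolding f_def
      by (simp add: bounded_linear_Blinfun_apply bounded_linear_compose[OF blinfun.bounded_linear_right J_simps(1)])
    ultimately show ?thesis using \<psi>(2)[of f] y by simp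
  qed
  then have "J 1 y = J 1 a" by (rule functional_separates_points)
  then have "y = a" using J_solves[of 1] by (metis zero_less_one)
  moreover have "\<psi> u = 0" using u(1)[OF J_in_D[OF h]] by (intro \<psi>(2)) simp
  ultimately show False using u(2) y by simp
qed

section \<open>Resolvents of generators and the method of continuity\<close>

lemma has_vector_derivative_at_right_quotient:
  assumes "(f has_vector_derivative v) (at x within {x..b})" "x < b"
  shows "((\<lambda>h. (f (x + h) - f x) /\<^sub>R h) \<longlongrightarrow> v) (at_right 0)"
proof -
  have "((\<lambda>y. ((f y - f x) - (y - x) *\<^sub>R v) /\<^sub>R norm (y - x)) \<longlongrightarrow> 0) (at_right x)"
    using assms by (simp add: has_vector_derivative_def has_derivative_within at_within_Icc_at_right
        divide_inverse algebra_simps)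
  then have "((\<lambda>h. ((f (x + h) - f x) - h *\<^sub>R v) /\<^sub>R \<bar>h\<bar>) \<longlongrightarrow> 0) (at_right 0)"
    by (simp add: at_right_to_0[of x] filterlim_filtermap add.commute)
  moreover have "\<forall>\<^sub>F h in at_right 0. ((f (x + h) - f x) - h *\<^sub>R v) /\<^sub>R \<bar>h\<bar> = (f (x + h) - f x) /\<^sub>R h - v"
    using eventually_at_right_less by eventually_elim (simp add: scaleR_diff_right)
  ultimately have "((\<lambda>h. (f (x + h) - f x) /\<^sub>R h - v) \<longlongrightarrow> 0) (at_right 0)"
    by (rule Lim_transform_eventually)
  then show ?thesis by (rule LIM_zero_cancel)
qed

text \<open>With \<open>Q s = exp (- s) T s\<close> and \<open>w = \<integral>\<^sub>0\<^sup>1 Q s y ds\<close> one has \<open>(1 - A) w = y - Q 1 y\<close>, and \<open>1 - Q 1\<close> is onto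
  since \<open>Q 1\<close> is a strict contraction. This avoids the improper Laplace integral.\<close>

lemma generator_range:
  fixes T :: "real \<Rightarrow> 'a::complex_banach \<Rightarrow> 'a"
  assumes T: "contraction_C0_semigroup T" and gen: "infinitesimal_generator T D A"
  shows "\<exists>x\<in>D. x - A x = v"
proof -
  define Q where "Q = (\<lambda>s x. exp (- s) *\<^sub>R T s x)"
  note TD = contraction_C0_semigroupD[OF T]
  have Q_linear: "bounded_linear (Q s)" if "s \<ge> 0" for s
    unfolding Q_def using TD(1)[OF that] by (rule bounded_linear_const_scaleR)
  have Q_add: "Q (s + t) x = Q s (Q t x)" if "s \<ge> 0" "t \<ge> 0" for s t x
    unfolding Q_def using TD(3)[OF that(2,1)] linear_simps(5)[OF TD(1)[OF that(1)]]
    by (simp add: mult_exp_exp)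
  have Q_0: "Q 0 x = x" for x by (simp add: Q_def TD(4)[OF order_refl])
  have Q_cont: "continuous_on {a..b} (\<lambda>s. Q s x)" if "a \<ge> 0" for a b x
    unfolding Q_def using that
    by (intro continuous_intros continuous_on_subset[OF TD(5)[of 0]]) auto
  have "\<exists>!y. v + Q 1 y = y"
  proof (rule banach_fix_type)
    show "\<forall>x y. dist (v + Q 1 x) (v + Q 1 y) \<le> exp (- 1) * dist x y"
    proof (intro allI)
      fix x y
      have "dist (v + Q 1 x) (v + Q 1 y) = exp (- 1) * norm (T 1 (x - y))"
        by (simp add: Q_def dist_norm linear_simps(2)[OF TD(1)] flip: scaleR_diff_right)
      then show "dist (v + Q 1 x) (v + Q 1 y) \<le> exp (- 1) * dist x y"
        using TD(2)[of 1 "x - y"] by (simp add: dist_norm)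
    qed
  qed auto
  then obtain y where y: "v + Q 1 y = y" by blast
  define F where "F = (\<lambda>t. integral {0..t} (\<lambda>s. Q s y))"
  define w where "w = F 1"
  have F_quotient: "((\<lambda>h. (F (x + h) - F x) /\<^sub>R h) \<longlongrightarrow> Q x y) (at_right 0)" if "x \<in> {0..1}" for x
  proof (rule has_vector_derivative_at_right_quotient)
    \<comment> \<open>The upper end 2 leaves room to the right of \<open>x = 1\<close>, where the
      quotient looks beyond the interval of integration of \<open>w\<close>.\<close>
    show "(F has_vector_derivative Q x y) (at x within {x..2})"
      unfolding F_def using that
      by (intro has_vector_derivative_within_subset[OF integral_has_vector_derivative[where a = 0 and b = 2, OF Q_cont]]) auto
  qed (use that in auto)
  have shift: "Q h w = F (1 + h) - F h" if "h > 0" for h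
  proof -
    have int: "(\<lambda>s. Q s y) integrable_on {a..b}" if "a \<ge> 0" for a b
      by (intro integrable_continuous_real Q_cont that)
    have "Q h w = integral {0..1} (Q h \<circ> (\<lambda>s. Q s y))"
      unfolding w_def F_def using Q_linear that int by (subst integral_linear) auto
    also have "\<dots> = integral {0..1} ((\<lambda>s. Q s y) \<circ> (+) h)"
      using that by (intro integral_cong) (simp add: Q_add)
    also have "\<dots> = integral {h..1 + h} (\<lambda>s. Q s y)"
      by (simp add: integral_shift_Icc_real)
    also have "\<dots> = F (1 + h) - F h"
      unfolding F_def using that Henstock_Kurzweil_Integration.integral_combine[of 0 h "1 + h" "\<lambda>s. Q s y"] int
      by (simp add: algebra_simps)
    finally show ?thesis .
  qed
  have exp_quotient: "((\<lambda>h. (exp h - 1) / h) \<longlongrightarrow> (1::real)) (at_right 0)"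
    using DERIV_exp[of 0] unfolding has_field_derivative_iff
    by (intro tendsto_within_subset[where S = UNIV and T = "{0<..}"]) auto
  \<comment> \<open>The product rule for \<open>T h w = exp h *\<^sub>R Q h w\<close>. By
    \<open>shift\<close>, the increment of \<open>Q h w\<close> consists of two boundary integrals,
    at 1 and at 0.\<close>
  have "((\<lambda>h. exp h *\<^sub>R ((F (1 + h) - F 1) /\<^sub>R h - (F (0 + h) - F 0) /\<^sub>R h) + ((exp h - 1) / h) *\<^sub>R w)
      \<longlongrightarrow> exp 0 *\<^sub>R (Q 1 y - Q 0 y) + 1 *\<^sub>R w) (at_right 0)"
    by (intro tendsto_intros F_quotient exp_quotient) auto
  moreover have "exp 0 *\<^sub>R (Q 1 y - Q 0 y) + 1 *\<^sub>R w = w - v"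
    using y by (simp add: Q_0 algebra_simps)
  moreover have "\<forall>\<^sub>F h in at_right 0.
      exp h *\<^sub>R ((F (1 + h) - F 1) /\<^sub>R h - (F (0 + h) - F 0) /\<^sub>R h) + ((exp h - 1) / h) *\<^sub>R w = (T h w - w) /\<^sub>R h"
    using eventually_at_right_less
  proof eventually_elim
    case (elim h)
    have Q: "Q h w - w = (F (1 + h) - F 1) - (F (0 + h) - F 0)"
      using shift[OF elim] by (simp add: w_def F_def)
    have "T h w = exp h *\<^sub>R Q h w" by (simp add: Q_def mult_exp_exp)
    then have "T h w - w = exp h *\<^sub>R (Q h w - w) + (exp h - 1) *\<^sub>R w"
      by (simp add: algebra_simps)
    then show ?case
      unfolding Q by (simp add: scaleR_add_right scaleR_diff_right divide_inverse mult.commute)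
  qed
  ultimately have lim: "((\<lambda>h. (T h w - w) /\<^sub>R h) \<longlongrightarrow> w - v) (at_right 0)"
    using Lim_transform_eventually by fastforce
  then have w: "w \<in> D" using gen unfolding infinitesimal_generator_def by blast
  have "A w = w - v"
    using tendsto_unique[OF _ infinitesimal_generatorD[OF gen w] lim] by simp
  with w show ?thesis by (intro bexI[of _ w]) auto
qed

text \<open>If the equation is solvable at \<open>s\<close>, the lower bound makes its solution map
  \<open>R\<close> Lipschitz with constant \<open>1 / c\<close>. At \<open>s'\<close> the solution
  is a fixed point of \<open>z \<mapsto> R (w + (s - s') *\<^sub>R B z)\<close>, a contraction once
  \<open>\<bar>s - s'\<bar> * K < c\<close>. This step length does not depend on \<open>s\<close>,
  so finitely many steps lead from 0 to 1.\<close>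

lemma range_by_continuity:
  fixes A B :: "'a::complex_banach \<Rightarrow> 'a"
  assumes lin: "linear_operator D A" and B: "bounded_linear B" and c: "c > 0"
    and lower: "\<And>s z. 0 \<le> s \<Longrightarrow> s \<le> 1 \<Longrightarrow> z \<in> D \<Longrightarrow> c * norm z \<le> norm (z + s *\<^sub>R B z - A z)"
    and start: "\<And>w. \<exists>z\<in>D. z - A z = w"
  shows "\<exists>z\<in>D. z + B z - A z = w"
proof -
  obtain K where K: "K > 0" "\<And>z. norm (B z) \<le> norm z * K"
    using bounded_linear.pos_bounded[OF B] by blast
  note lin = linear_operatorD[OF lin]
  interpret B: bounded_linear B by fact
  have step: "\<exists>z\<in>D. z + s' *\<^sub>R B z - A z = w"
    if onto: "\<And>w. \<exists>z\<in>D. z + s *\<^sub>R B z - A z = w"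
      and s: "0 \<le> s" "s \<le> 1" "\<bar>s - s'\<bar> * K < c" for s s' w
  proof -
    from onto obtain R where R: "\<And>w. R w \<in> D" "\<And>w. R w + s *\<^sub>R B (R w) - A (R w) = w" by metis
    have R_lipschitz: "norm (R x - R y) \<le> norm (x - y) / c" for x y
    proof -
      have "c * norm (R x - R y) \<le> norm ((R x - R y) + s *\<^sub>R B (R x - R y) - A (R x - R y))"
        using s R by (intro lower lin)
      also have "(R x - R y) + s *\<^sub>R B (R x - R y) - A (R x - R y) =
          (R x + s *\<^sub>R B (R x) - A (R x)) - (R y + s *\<^sub>R B (R y) - A (R y))"
        using R(1) by (simp add: lin B.diff scaleR_diff_right)
      finally show ?thesis using c R(2) by (simp add: field_simps)
    qed
    have "\<exists>!z. R (w + (s - s') *\<^sub>R B z) = z"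
    proof (rule banach_fix_type)
      show "\<forall>x y. dist (R (w + (s - s') *\<^sub>R B x)) (R (w + (s - s') *\<^sub>R B y)) \<le> (\<bar>s - s'\<bar> * K / c) * dist x y"
      proof (intro allI)
        fix x y
        have "dist (R (w + (s - s') *\<^sub>R B x)) (R (w + (s - s') *\<^sub>R B y)) \<le> norm ((s - s') *\<^sub>R B (x - y)) / c"
          using R_lipschitz[of "w + (s - s') *\<^sub>R B x" "w + (s - s') *\<^sub>R B y"]
          by (simp add: dist_norm B.diff scaleR_diff_right)
        also have "\<dots> \<le> \<bar>s - s'\<bar> * (norm (x - y) * K) / c"
          using K(2)[of "x - y"] c by (auto intro!: divide_right_mono mult_left_mono)
        finally show "dist (R (w + (s - s') *\<^sub>R B x)) (R (w + (s - s') *\<^sub>R B y)) \<le> (\<bar>s - s'\<bar> * K / c) * dist x y"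
          by (simp add: dist_norm mult_ac)
      qed
    qed (use s c K in auto)
    then obtain z where z: "R (w + (s - s') *\<^sub>R B z) = z" by blast
    then have "z \<in> D" "z + s *\<^sub>R B z - A z = w + (s - s') *\<^sub>R B z"
      using R[of "w + (s - s') *\<^sub>R B z"] by auto
    then show ?thesis by (intro bexI[of _ z]) (auto simp: algebra_simps)
  qed
  obtain n :: nat where n: "K / c < n" using reals_Archimedean2 by blast
  then have n0: "n > 0" using K c by (metis divide_pos_pos less_trans of_nat_0_less_iff)
  have "\<exists>z\<in>D. z + (real k / n) *\<^sub>R B z - A z = w" if "k \<le> n" for k w
    using that
  proof (induction k arbitrary: w)
    case (Suc k)
    show ?case
    proof (rule step[where s = "real k / n"])
      show "\<exists>z\<in>D. z + (real k / n) *\<^sub>R B z - A z = w" for w using Suc by simp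
      have "real k / n - real (Suc k) / n = - (1 / n)" by (simp add: diff_divide_distrib[symmetric])
      then show "\<bar>real k / n - real (Suc k) / n\<bar> * K < c" using n c n0 by (simp add: field_simps)
    qed (use Suc n0 in \<open>auto simp: field_simps\<close>)
  qed (use start in simp)
  from this[of n w] show ?thesis using n0 by simp
qed

lemma semi_inner_productD:
  assumes "semi_inner_product ip"
  shows "ip (x + z) y = ip x y + ip z y" "ip (x - z) y = ip x y - ip z y"
    "ip (r *\<^sub>R x) y = r * ip x y" "ip x x = complex_of_real ((norm x)\<^sup>2)"
    "Re (ip x y) \<le> norm x * norm y"
proof -
  have lin: "ip (x + c *\<^sub>C z) y = ip x y + c * ip z y" and self: "ip x x = complex_of_real ((norm x)\<^sup>2)"
    and cs: "(cmod (ip x y))\<^sup>2 \<le> Re (ip x x * ip y y)" for x y z c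
    using assms by (auto simp: semi_inner_product_def)
  show "ip (x + z) y = ip x y + ip z y" using lin[of x 1 z y] scaleC_of_real[of 1 z] by simp
  show "ip (x - z) y = ip x y - ip z y" using lin[of x "-1" z y] scaleC_of_real[of "-1" z] by simp
  have "ip 0 y = 0" using lin[of 0 "complex_of_real 1" 0 y] by (simp only: scaleC_of_real) simp
  then show "ip (r *\<^sub>R x) y = r * ip x y" using lin[of 0 "complex_of_real r" x y] by (simp add: scaleC_of_real)
  show "ip x x = complex_of_real ((norm x)\<^sup>2)" by (rule self)
  have "(cmod (ip x y))\<^sup>2 \<le> (norm x * norm y)\<^sup>2"
    using cs[of x y] by (simp add: self power_mult_distrib flip: of_real_power of_real_mult)
  then have "cmod (ip x y) \<le> norm x * norm y" by (rule power2_le_imp_le) simp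
  then show "Re (ip x y) \<le> norm x * norm y" using complex_Re_le_cmod order_trans by blast
qed

text \<open>Cauchy-Schwarz in the plane, applied to the pairs of component norms.\<close>

lemma norm_prod_cauchy_schwarz:
  fixes x y :: "'a::real_normed_vector \<times> 'b::real_normed_vector"
  shows
  "norm (fst x) * norm (fst y) + norm (snd x) * norm (snd y) \<le> norm x * norm y"
proof -
  have "norm (norm (fst z), norm (snd z)) = norm z" for z :: "'a \<times> 'b"
    by (simp add: norm_prod_def)
  then show ?thesis
    using norm_cauchy_schwarz[of "(norm (fst x), norm (snd x))" "(norm (fst y), norm (snd y))"]
    by simp
qed

text \<open>Compares \<open>norm (z + h v)\<close> with \<open>norm z\<close> for small \<open>h > 0\<close>, so that no duality section is needed
  on the first factor.\<close>

lemma prod_generator_dissipative: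
  fixes T :: "real \<Rightarrow> 'a::complex_normed_vector \<times> 'b::complex_normed_vector \<Rightarrow> 'a \<times> 'b"
  assumes T: "contraction_C0_semigroup T"
    and lim: "((\<lambda>h. (T h z - z) /\<^sub>R h) \<longlongrightarrow> v) (at_right 0)"
    and ip: "semi_inner_product ip"
  shows "\<mu> * (norm (fst z))\<^sup>2 + Re (ip (snd v) (snd z)) \<le> norm (\<mu> *\<^sub>R fst z - fst v) * norm (fst z)"
proof (rule field_le_epsilon)
  fix e :: real assume e: "e > 0"
  note ip = semi_inner_productD[OF ip]
  define d where "d = e / (norm z + 1)"
  have d: "d > 0" "d * norm z \<le> e"
  proof -
    show "d > 0" using e unfolding d_def by (intro divide_pos_pos) (auto intro: add_nonneg_pos)
    have "d * norm z \<le> d * (norm z + 1)" using \<open>d > 0\<close> by simp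
    also have "\<dots> = e" using norm_ge_zero[of z] by (simp add: d_def add_nonneg_eq_0_iff)
    finally show "d * norm z \<le> e" .
  qed
  have "\<forall>\<^sub>F h in at_right 0. norm (z + h *\<^sub>R v) \<le> norm z + d * h \<and> h > 0"
    using d by (intro eventually_conj semigroup_norm_forward_le[OF T lim] eventually_at_right_less)
  then obtain h where h: "norm (z + h *\<^sub>R v) \<le> norm z + d * h" "h > 0"
    using eventually_happens'[of "at_right (0::real)"] by force
  obtain z1 z2 v1 v2 where zv: "z = (z1, z2)" "v = (v1, v2)" by (cases z, cases v)
  \<comment> \<open>The triangle inequality bounds the first component of
    \<open>z + h *\<^sub>R v\<close> from below, as a pairing would; the second one is bounded
    through \<open>ip\<close>.\<close>
  have "(1 + h * \<mu>) *\<^sub>R z1 = (z1 + h *\<^sub>R v1) + h *\<^sub>R (\<mu> *\<^sub>R z1 - v1)" by (simp add: algebra_simps)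
  then have "norm ((1 + h * \<mu>) *\<^sub>R z1) \<le> norm (z1 + h *\<^sub>R v1) + norm (h *\<^sub>R (\<mu> *\<^sub>R z1 - v1))"
    by (simp only: norm_triangle_ineq)
  moreover have "(1 + h * \<mu>) * norm z1 \<le> norm ((1 + h * \<mu>) *\<^sub>R z1)"
    by (simp add: mult_right_mono)
  ultimately have "(1 + h * \<mu>) * norm z1 - h * norm (\<mu> *\<^sub>R z1 - v1) \<le> norm (z1 + h *\<^sub>R v1)"
    using h by simp
  then have 1: "((1 + h * \<mu>) * norm z1 - h * norm (\<mu> *\<^sub>R z1 - v1)) * norm z1 \<le> norm (z1 + h *\<^sub>R v1) * norm z1"
    by (rule mult_right_mono) simp
  have 2: "(norm z2)\<^sup>2 + h * Re (ip v2 z2) \<le> norm (z2 + h *\<^sub>R v2) * norm z2"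
    using ip(5)[of "z2 + h *\<^sub>R v2" z2] by (simp add: ip(1,3,4))
  have "norm (z1 + h *\<^sub>R v1) * norm z1 + norm (z2 + h *\<^sub>R v2) * norm z2 \<le> norm (z + h *\<^sub>R v) * norm z"
    using norm_prod_cauchy_schwarz[of "z + h *\<^sub>R v" z] by (simp add: zv)
  also have "\<dots> \<le> (norm z + d * h) * norm z" using h by (intro mult_right_mono) auto
  also have "\<dots> = (norm z)\<^sup>2 + h * (d * norm z)" by (simp add: algebra_simps power2_eq_square)
  also have "\<dots> \<le> (norm z)\<^sup>2 + h * e" using d h by (intro add_left_mono mult_left_mono) auto
  also have "(norm z)\<^sup>2 = (norm z1)\<^sup>2 + (norm z2)\<^sup>2" by (simp add: zv norm_Pair)
  finally have "h * (\<mu> * (norm z1)\<^sup>2 + Re (ip v2 z2)) \<le> h * (norm (\<mu> *\<^sub>R z1 - v1) * norm z1 + e)"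
    using 1 2 by (simp add: algebra_simps power2_eq_square)
  then show "\<mu> * (norm (fst z))\<^sup>2 + Re (ip (snd v) (snd z)) \<le> norm (\<mu> *\<^sub>R fst z - fst v) * norm (fst z) + e"
    using h(2) by (simp add: zv)
qed


section \<open>The feedback operator\<close>

lemma linear_operator_ext:
  assumes "linear_operator D\<^sub>1 A\<^sub>1" "linear_operator D\<^sub>2 A\<^sub>2"
  shows "linear_operator (ext_dom D\<^sub>1 D\<^sub>2) (ext_op A\<^sub>1 A\<^sub>2)"
proof -
  note lin = linear_operatorD[OF assms(1)] linear_operatorD[OF assms(2)]
  show ?thesis
  proof (rule linear_operatorI)
    show "0 \<in> ext_dom D\<^sub>1 D\<^sub>2" using lin(1,11) by (simp add: ext_dom_def zero_prod_def)
  next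
    fix x y c assume "x \<in> ext_dom D\<^sub>1 D\<^sub>2" "y \<in> ext_dom D\<^sub>1 D\<^sub>2"
    then have D: "x \<in> D\<^sub>1" "y \<in> D\<^sub>1" "fst x \<in> D\<^sub>2" "fst y \<in> D\<^sub>2" by (auto simp: ext_dom_def)
    have fst: "fst (x + c *\<^sub>C y) = fst x + c *\<^sub>C fst y" by (simp add: scaleC_prod_def)
    have "x + c *\<^sub>C y \<in> D\<^sub>1" "fst (x + c *\<^sub>C y) \<in> D\<^sub>2"
      unfolding fst using D by (auto intro: lin)
    then show "x + c *\<^sub>C y \<in> ext_dom D\<^sub>1 D\<^sub>2" by (cases "x + c *\<^sub>C y") (simp add: ext_dom_def)
    have "A\<^sub>1 (x + c *\<^sub>C y) = A\<^sub>1 x + c *\<^sub>C A\<^sub>1 y" "A\<^sub>2 (fst (x + c *\<^sub>C y)) = A\<^sub>2 (fst x) + c *\<^sub>C A\<^sub>2 (fst y)"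
      unfolding fst using D by (simp_all add: lin)
    moreover have "c *\<^sub>C (A\<^sub>1 y, A\<^sub>2 (fst y)) = (c *\<^sub>C A\<^sub>1 y, c *\<^sub>C A\<^sub>2 (fst y))"
      by (simp add: scaleC_prod_def)
    moreover have "ext_op A\<^sub>1 A\<^sub>2 z = (A\<^sub>1 z, A\<^sub>2 (fst z))" for z
      by (simp add: ext_op_def split_beta)
    ultimately show "ext_op A\<^sub>1 A\<^sub>2 (x + c *\<^sub>C y) = ext_op A\<^sub>1 A\<^sub>2 x + c *\<^sub>C ext_op A\<^sub>1 A\<^sub>2 y"
      by simp
  qed
qed

lemma linear_operator_feedback:
  assumes "linear_operator D\<^sub>1 A\<^sub>1" "linear_operator D\<^sub>2 A\<^sub>2" and S: "bounded_clinear S"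
  shows "linear_operator (feedback_dom D\<^sub>1 D\<^sub>2 A\<^sub>2 S) (feedback_op A\<^sub>1 A\<^sub>2 S)"
proof -
  note lin = linear_operatorD[OF assms(1)] linear_operatorD[OF assms(2)]
  note S = S[unfolded bounded_clinear_def]
  have S_add: "S (x + c *\<^sub>C y) = S x + c *\<^sub>C S y" for x y c
    using S by (simp add: linear_simps(1))
  show ?thesis
  proof (rule linear_operatorI)
    have "A\<^sub>2 0 = 0" using lin(17)[OF lin(11) lin(11)] by simp
    then show "0 \<in> feedback_dom D\<^sub>1 D\<^sub>2 A\<^sub>2 S"
      using lin(1,11) S by (simp add: feedback_dom_def ext_dom_def linear_simps(3) zero_prod_def)
  next
    fix x y c assume "x \<in> feedback_dom D\<^sub>1 D\<^sub>2 A\<^sub>2 S" "y \<in> feedback_dom D\<^sub>1 D\<^sub>2 A\<^sub>2 S"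
    then have D: "x \<in> D\<^sub>2" "y \<in> D\<^sub>2" "(x, S (A\<^sub>2 x)) \<in> D\<^sub>1" "(y, S (A\<^sub>2 y)) \<in> D\<^sub>1"
      by (auto simp: feedback_dom_def ext_dom_def)
    have "A\<^sub>2 (x + c *\<^sub>C y) = A\<^sub>2 x + c *\<^sub>C A\<^sub>2 y" using D by (simp add: lin)
    then have graph: "(x + c *\<^sub>C y, S (A\<^sub>2 (x + c *\<^sub>C y))) = (x, S (A\<^sub>2 x)) + c *\<^sub>C (y, S (A\<^sub>2 y))"
      by (simp add: scaleC_prod_def S_add)
    have "x + c *\<^sub>C y \<in> D\<^sub>2" "(x + c *\<^sub>C y, S (A\<^sub>2 (x + c *\<^sub>C y))) \<in> D\<^sub>1"
      unfolding graph using D by (auto intro: lin)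
    then show "x + c *\<^sub>C y \<in> feedback_dom D\<^sub>1 D\<^sub>2 A\<^sub>2 S" by (simp add: feedback_dom_def ext_dom_def)
    show "feedback_op A\<^sub>1 A\<^sub>2 S (x + c *\<^sub>C y) = feedback_op A\<^sub>1 A\<^sub>2 S x + c *\<^sub>C feedback_op A\<^sub>1 A\<^sub>2 S y"
      unfolding feedback_op_def graph using D by (simp add: lin)
  qed
qed

lemma feedback_m_dissipative:
  fixes D\<^sub>1 :: "('a::complex_banach \<times> 'b::complex_banach) set"
    and ip :: "'b \<Rightarrow> 'b \<Rightarrow> complex"
  assumes lin: "linear_operator D\<^sub>1 A\<^sub>1" "linear_operator D\<^sub>2 A\<^sub>2"
    and gen: "generates_contraction_C0_semigroup (ext_dom D\<^sub>1 D\<^sub>2) (ext_op A\<^sub>1 A\<^sub>2)"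
    and S: "bounded_clinear S" "boundedly_invertible S"
    and ip: "semi_inner_product ip"
    and m: "m > 0" "\<And>x. Re (ip x (S x)) \<ge> m * (norm x)\<^sup>2"
  shows "m_dissipative (feedback_dom D\<^sub>1 D\<^sub>2 A\<^sub>2 S) (feedback_op A\<^sub>1 A\<^sub>2 S)"
proof -
  let ?D = "ext_dom D\<^sub>1 D\<^sub>2" and ?A = "ext_op A\<^sub>1 A\<^sub>2"
  obtain T where T: "contraction_C0_semigroup T" and gT: "infinitesimal_generator T ?D ?A"
    using gen unfolding generates_contraction_C0_semigroup_def by blast
  note ipD = semi_inner_productD[OF ip]
  have diss: "\<mu> * (norm (fst z))\<^sup>2 + Re (ip (snd (?A z)) (snd z)) \<le> norm (\<mu> *\<^sub>R fst z - fst (?A z)) * norm (fst z)"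
    if "z \<in> ?D" for z \<mu>
    by (rule prod_generator_dissipative[OF T infinitesimal_generatorD[OF gT that] ip])
  define M where "M = inv S"
  have SM: "S (M y) = y" "M (S y) = y" for y
    using S(2) unfolding boundedly_invertible_def M_def bij_def by (simp_all add: surj_f_inv_f)
  have M: "bounded_linear M"
    using S(2) unfolding boundedly_invertible_def M_def bounded_clinear_def by simp
  obtain K where K: "K > 0" "\<And>x. norm (S x) \<le> norm x * K"
    using S(1) bounded_linear.pos_bounded unfolding bounded_clinear_def by blast
  \<comment> \<open>With \<open>x = M y\<close> the hypothesis on \<open>S\<close> gives at least
    \<open>m * (norm (M y))\<^sup>2\<close>, and \<open>norm y \<le> norm (M y) * K\<close>; this
    turns accretivity of \<open>S\<close> into coercivity of its inverse.\<close>
  define \<delta> where "\<delta> = m / K\<^sup>2"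
  have \<delta>: "\<delta> > 0" using m K by (simp add: \<delta>_def)
  have M_coercive: "\<delta> * (norm y)\<^sup>2 \<le> Re (ip (M y) y)" for y
  proof -
    have "(norm y)\<^sup>2 \<le> (norm (M y) * K)\<^sup>2" using K(2)[of "M y"] by (intro power_mono) (auto simp: SM)
    then have "\<delta> * (norm y)\<^sup>2 \<le> m * (norm (M y))\<^sup>2"
      using K(1) m(1) by (simp add: \<delta>_def field_simps power_mult_distrib)
    then show ?thesis using m(2)[of "M y"] by (simp add: SM)
  qed
  have range: "\<exists>x\<in>feedback_dom D\<^sub>1 D\<^sub>2 A\<^sub>2 S. \<mu> *\<^sub>R x - feedback_op A\<^sub>1 A\<^sub>2 S x = y"
    if \<mu>: "\<mu> > 0" for \<mu> y
  proof -
    \<comment> \<open>The identity plus \<open>B\<close> is the diagonal operator with entries \<mu>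
      and \<open>M\<close>, so \<open>s *\<^sub>R B\<close> traces the segment towards it.\<close>
    define B where "B = (\<lambda>z :: 'a \<times> 'b. ((\<mu> - 1) *\<^sub>R fst z, M (snd z) - snd z))"
    have B: "bounded_linear B"
      unfolding B_def
      by (intro bounded_linear_Pair bounded_linear_sub bounded_linear_compose[OF M]
          bounded_linear_const_scaleR bounded_linear_fst bounded_linear_snd)
    \<comment> \<open>Along the segment the two components carry convex combinations of 1 with \<mu>
      and of 1 with \<delta>; all of them are at least \<open>c\<close>.\<close>
    define c where "c = min 1 (min \<mu> \<delta>)"
    have c: "c > 0" "c \<le> 1" "c \<le> \<mu>" "c \<le> \<delta>" using \<mu> \<delta> by (auto simp: c_def)
    have "c * norm z \<le> norm (z + s *\<^sub>R B z - ?A z)" if s: "0 \<le> s" "s \<le> 1" and z: "z \<in> ?D" for s z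
    proof -
      define w where "w = z + s *\<^sub>R B z - ?A z"
      define \<nu> where "\<nu> = 1 + s * (\<mu> - 1)"
      have w1: "fst w = \<nu> *\<^sub>R fst z - fst (?A z)"
        by (simp add: w_def B_def \<nu>_def algebra_simps)
      have w2: "snd (?A z) = (snd z + s *\<^sub>R (M (snd z) - snd z)) - snd w"
        by (simp add: w_def B_def)
      have convex: "c \<le> (1 - s) * 1 + s * d" if "c \<le> d" for d
      proof -
        have "(1 - s) * c + s * c \<le> (1 - s) * 1 + s * d" using s c that by (intro add_mono mult_left_mono) auto
        then show ?thesis by (simp add: algebra_simps)
      qed
      have \<nu>: "c \<le> \<nu>" using convex[OF c(3)] by (simp add: \<nu>_def algebra_simps)
      have "Re (ip (snd z + s *\<^sub>R (M (snd z) - snd z)) (snd z)) = (1 - s) * (norm (snd z))\<^sup>2 + s * Re (ip (M (snd z)) (snd z))"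
        by (simp add: ipD algebra_simps)
      also have "\<dots> \<ge> (1 - s) * (norm (snd z))\<^sup>2 + s * (\<delta> * (norm (snd z))\<^sup>2)"
        using s by (intro add_left_mono mult_left_mono M_coercive) auto
      finally have 1: "((1 - s) * 1 + s * \<delta>) * (norm (snd z))\<^sup>2 \<le> Re (ip (snd z + s *\<^sub>R (M (snd z) - snd z)) (snd z))"
        by (simp add: algebra_simps)
      have 2: "Re (ip (snd (?A z)) (snd z)) = Re (ip (snd z + s *\<^sub>R (M (snd z) - snd z)) (snd z)) - Re (ip (snd w) (snd z))"
        unfolding w2 ipD(2) by simp
      have "c * (norm z)\<^sup>2 = c * (norm (fst z))\<^sup>2 + c * (norm (snd z))\<^sup>2"
        by (simp add: norm_prod_def algebra_simps)
      also have "\<dots> \<le> \<nu> * (norm (fst z))\<^sup>2 + ((1 - s) * 1 + s * \<delta>) * (norm (snd z))\<^sup>2"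
        by (intro add_mono mult_right_mono \<nu> convex c) auto
      also have "\<dots> \<le> norm (fst w) * norm (fst z) + norm (snd w) * norm (snd z)"
        using diss[OF z, of \<nu>] 1 2 ipD(5)[of "snd w" "snd z"] unfolding w1 by linarith
      also have "\<dots> \<le> norm w * norm z" by (rule norm_prod_cauchy_schwarz)
      finally have "(c * norm z) * norm z \<le> norm w * norm z" by (simp add: power2_eq_square mult.assoc)
      then show ?thesis
        unfolding w_def[symmetric] by (cases "z = 0") auto
    qed
    then obtain z where z: "z \<in> ?D" "z + B z - ?A z = (y, 0)"
      using range_by_continuity[OF linear_operator_ext[OF lin] B c(1), of "(y, 0)"] generator_range[OF T gT] by metis
    obtain x\<^sub>1 x\<^sub>2 where x: "z = (x\<^sub>1, x\<^sub>2)" by (cases z)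
    \<comment> \<open>The zero in the second component of the right-hand side yields the feedback
      relation.\<close>
    have "M x\<^sub>2 = A\<^sub>2 x\<^sub>1" and eq: "\<mu> *\<^sub>R x\<^sub>1 - A\<^sub>1 (x\<^sub>1, x\<^sub>2) = y"
      using z(2) by (auto simp: x B_def ext_op_def algebra_simps)
    then have "x\<^sub>2 = S (A\<^sub>2 x\<^sub>1)" using SM by metis
    then show ?thesis
      using z(1) eq by (intro bexI[of _ x\<^sub>1]) (auto simp: x feedback_dom_def feedback_op_def ext_dom_def)
  qed
  show ?thesis
  proof
    show "linear_operator (feedback_dom D\<^sub>1 D\<^sub>2 A\<^sub>2 S) (feedback_op A\<^sub>1 A\<^sub>2 S)"
      by (rule linear_operator_feedback[OF lin S(1)])
  next
    fix x and h :: real assume x: "x \<in> feedback_dom D\<^sub>1 D\<^sub>2 A\<^sub>2 S" and h: "h > 0"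
    define a where "a = feedback_op A\<^sub>1 A\<^sub>2 S x"
    have "Re (ip (A\<^sub>2 x) (S (A\<^sub>2 x))) \<ge> 0" using m order_trans[OF _ m(2)] by simp
    then have "(1 / h) * (norm x)\<^sup>2 \<le> norm ((1 / h) *\<^sub>R x - a) * norm x"
      using diss[of "(x, S (A\<^sub>2 x))" "1 / h"] x
      by (simp add: feedback_dom_def feedback_op_def ext_op_def a_def)
    then have "((1 / h) * norm x) * norm x \<le> norm ((1 / h) *\<^sub>R x - a) * norm x"
      by (simp add: power2_eq_square)
    then have "(1 / h) * norm x \<le> norm ((1 / h) *\<^sub>R x - a)"
      by (cases "x = 0") (simp, metis mult_right_le_imp_le zero_less_norm_iff)
    then have "norm x \<le> h * norm ((1 / h) *\<^sub>R x - a)" using h by (simp add: field_simps)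
    also have "\<dots> = norm (h *\<^sub>R ((1 / h) *\<^sub>R x - a))" using h by simp
    also have "h *\<^sub>R ((1 / h) *\<^sub>R x - a) = x - h *\<^sub>R a" using h by (simp add: scaleR_diff_right)
    finally show "norm x \<le> norm (x - h *\<^sub>R feedback_op A\<^sub>1 A\<^sub>2 S x)" by (simp add: a_def)
  next
    fix h :: real and y assume h: "h > 0"
    then obtain x where x: "x \<in> feedback_dom D\<^sub>1 D\<^sub>2 A\<^sub>2 S"
        "(1 / h) *\<^sub>R x - feedback_op A\<^sub>1 A\<^sub>2 S x = (1 / h) *\<^sub>R y"
      using range[of "1 / h" "(1 / h) *\<^sub>R y"] by auto
    have "x - h *\<^sub>R feedback_op A\<^sub>1 A\<^sub>2 S x = h *\<^sub>R ((1 / h) *\<^sub>R x - feedback_op A\<^sub>1 A\<^sub>2 S x)"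
      using h by (simp add: scaleR_diff_right)
    also have "\<dots> = y" unfolding x(2) using h by simp
    finally show "\<exists>x\<in>feedback_dom D\<^sub>1 D\<^sub>2 A\<^sub>2 S. x - h *\<^sub>R feedback_op A\<^sub>1 A\<^sub>2 S x = y" using x(1) by blast
  qed
qed


theorem theorem2p1:
  fixes D\<^sub>1 :: "('a::complex_banach \<times> 'b::complex_banach) set"
    and A\<^sub>1 :: "'a \<times> 'b \<Rightarrow> 'a"
    and D\<^sub>2 :: "'a set"
    and A\<^sub>2 :: "'a \<Rightarrow> 'b"
    and S :: "'b \<Rightarrow> 'b"
  assumes "linear_operator D\<^sub>1 A\<^sub>1"
    and "linear_operator D\<^sub>2 A\<^sub>2"
    and "generates_contraction_C0_semigroup (ext_dom D\<^sub>1 D\<^sub>2) (ext_op A\<^sub>1 A\<^sub>2)"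
    and "bounded_clinear S"
    and "boundedly_invertible S"
    and "\<exists>m\<^sub>2>0. \<exists>ip :: 'b \<Rightarrow> 'b \<Rightarrow> complex. semi_inner_product ip \<and>
           (\<forall>x. Re (ip x (S x)) \<ge> m\<^sub>2 * (norm x)\<^sup>2)"
    and "closure (feedback_dom D\<^sub>1 D\<^sub>2 A\<^sub>2 S) = UNIV \<or> reflexive_space TYPE('a)"
  shows "generates_contraction_C0_semigroup (feedback_dom D\<^sub>1 D\<^sub>2 A\<^sub>2 S) (feedback_op A\<^sub>1 A\<^sub>2 S)"
proof -
  interpret m_dissipative "feedback_dom D\<^sub>1 D\<^sub>2 A\<^sub>2 S" "feedback_op A\<^sub>1 A\<^sub>2 S"
    using assms(6) feedback_m_dissipative[OF assms(1-5)] by blast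
  interpret dense_m_dissipative "feedback_dom D\<^sub>1 D\<^sub>2 A\<^sub>2 S" "feedback_op A\<^sub>1 A\<^sub>2 S"
    by unfold_locales (use assms(7) reflexive_dense in blast)
  show ?thesis by (rule generates_semigroup)
qed

end
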